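(* Let $d\ge1$, and consider solutions, with $f>0$ and $|f'|<1$, of $$[1-(f')^2]\,d+f f''=(d+1)[1-(f')^2]^{3/2}f .$$ Let $t_0\in\mathbb{R}$. (1) For every $r_0\in\mathbb{R}_+$ there exists exactly one $\lambda_0\in(-1,1)$ such that the solution with data $f(t_0)=r_0$ and $f'(t_0)=\lambda_0$ satisfies $\lim_{t\to\infty}f(t)=\frac{d}{d+1}$; solutions with $f(t_0)=r_0$ and $f'(t_0)>\lambda_0$ (respectively $f'(t_0)<\lambda_0$) expand indefinitely (respectively collapse in finite time) to the future. (2) For every $\lambda_0\in(-1,1)$ there exists exactly one $r_0\in\mathbb{R}_+$ such that the solution with data $f(t_0)=r_0$ and $f'(t_0)=\lambda_0$ satisfies $\lim_{t\to\infty}f(t)=\frac{d}{d+1}$; solutions with $f'(t_0)=\lambda_0$ and $f(t_0)>r_0$ (respectively $f(t_0)<r_0$) expand indefinitely (respectively collapse in finite time) to the future.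
   Context: $\mathbb{R}_+=(0,\infty)$. The equation expresses that the spherically symmetric time-like hypersurface $\{r=f(t)\}\subset\mathbb{R}^{1,d+1}$ has constant mean curvature $d+1$. "Expands indefinitely to the future" means the solution exists on $[t_0,\infty)$ and $\lim_{t\to\infty}f(t)=\infty$; "collapses in finite time to the future" means there is a finite $T>t_0$ such that the solution exists on $[t_0,T)$ and $\lim_{t\nearrow T}f(t)=0$. *)

theory Defs
  imports "HOL-Analysis.Analysis"
begin

definition cmc_solution :: "nat \<Rightarrow> (real \<Rightarrow> real) \<Rightarrow> real set \<Rightarrow> bool" where
  "cmc_solution d f J \<longleftrightarrow>
     open J \<and> is_interval J \<and>
     (\<forall>t\<in>J. f differentiable (at t) \<and> deriv f differentiable (at t) \<and>
        f t > 0 \<and> \<bar>deriv f t\<bar> < 1 \<and>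
        (1 - (deriv f t)\<^sup>2) * real d + f t * deriv (deriv f) t
          = (real d + 1) * (1 - (deriv f t)\<^sup>2) powr (3 / 2) * f t)"

text \<open>
  A solution is a pair of a function and an open interval of existence; the values of the
  function outside that interval are irrelevant.
\<close>

definition maximal_cmc_solution :: "nat \<Rightarrow> (real \<Rightarrow> real) \<Rightarrow> real set \<Rightarrow> bool" where
  "maximal_cmc_solution d f J \<longleftrightarrow>
     cmc_solution d f J \<and>
     (\<forall>g K. cmc_solution d g K \<and> J \<subseteq> K \<and> (\<forall>t\<in>J. g t = f t) \<longrightarrow> K = J)"

definition maximal_cmc_solution_with_data ::
    "nat \<Rightarrow> real \<Rightarrow> real \<Rightarrow> real \<Rightarrow> (real \<Rightarrow> real) \<Rightarrow> real set \<Rightarrow> bool" where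
  "maximal_cmc_solution_with_data d t0 r l f J \<longleftrightarrow>
     maximal_cmc_solution d f J \<and> t0 \<in> J \<and> f t0 = r \<and> deriv f t0 = l"

text \<open>
  ``The solution with data \<open>f t0 = r\<close>, \<open>deriv f t0 = l\<close> satisfies \<open>P\<close>'': a maximal solution with
  these data exists, and every such solution satisfies \<open>P\<close>.  The universal quantifier also covers
  the arbitrary values of \<open>f\<close> outside \<open>J\<close>.
\<close>

definition the_cmc_solution_satisfies ::
    "nat \<Rightarrow> real \<Rightarrow> real \<Rightarrow> real \<Rightarrow> ((real \<Rightarrow> real) \<Rightarrow> real set \<Rightarrow> bool) \<Rightarrow> bool" where
  "the_cmc_solution_satisfies d t0 r l P \<longleftrightarrow>
     (\<exists>f J. maximal_cmc_solution_with_data d t0 r l f J) \<and>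
     (\<forall>f J. maximal_cmc_solution_with_data d t0 r l f J \<longrightarrow> P f J)"

definition converges_to_future :: "real \<Rightarrow> real \<Rightarrow> (real \<Rightarrow> real) \<Rightarrow> real set \<Rightarrow> bool" where
  "converges_to_future t0 c f J \<longleftrightarrow> {t0..} \<subseteq> J \<and> (f \<longlongrightarrow> c) at_top"

definition expands_indefinitely :: "real \<Rightarrow> (real \<Rightarrow> real) \<Rightarrow> real set \<Rightarrow> bool" where
  "expands_indefinitely t0 f J \<longleftrightarrow> {t0..} \<subseteq> J \<and> filterlim f at_top at_top"

definition collapses_in_finite_time :: "real \<Rightarrow> (real \<Rightarrow> real) \<Rightarrow> real set \<Rightarrow> bool" where
  "collapses_in_finite_time t0 f J \<longleftrightarrow>
     (\<exists>T>t0. {t0..<T} \<subseteq> J \<and> (f \<longlongrightarrow> 0) (at_left T))"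

definition has_critical_data :: "nat \<Rightarrow> real \<Rightarrow> real \<Rightarrow> real \<Rightarrow> bool" where
  "has_critical_data d t0 r l \<longleftrightarrow>
     the_cmc_solution_satisfies d t0 r l (converges_to_future t0 (real d / (real d + 1)))"

end

theory Submission imports Defs begin

text \<open>
  The equation has a first integral.  Write \<open>\<gamma> = 1 / sqrt (1 - f'\<^sup>2)\<close> for the Lorentz factor of the
  velocity and \<open>c = d / (d + 1)\<close> for the radius of the static solution.  Then
  \<open>E = f ^ d * (\<gamma> - f)\<close> is constant along every solution, so that \<open>\<gamma> = f + E / f ^ d\<close>.  At the energy
  \<open>E\<^sub>c\<close> of the static solution the right-hand side is the function \<open>h\<close> called
  \<open>critical_lorentz_factor\<close> below.  It has its strict minimum \<open>h c = 1\<close> at \<open>c\<close>, and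
  \<open>E - E\<^sub>c = f ^ d * (\<gamma> - h f)\<close>.  The motion is that of a particle at a potential barrier with top at \<open>c\<close>:

  \<^item> If \<open>E > E\<^sub>c\<close>, then \<open>\<gamma> > h f \<ge> 1\<close> for all times, so the velocity never vanishes and the
    solution crosses the barrier in the direction of its initial velocity
    (\<open>supercritical_cmc_solution\<close>).

  \<^item> If \<open>E \<le> E\<^sub>c\<close> and the solution is not static, then it never meets the radius \<open>c\<close>, and the
    acceleration points away from \<open>c\<close> for all times.  Either the velocity at some time points away
    from \<open>c\<close>, and from then on the solution runs away on its side of \<open>c\<close>; or it points towards \<open>c\<close>
    forever, and then \<open>f\<close> converges (\<open>subcritical_cmc_solution_outside\<close>,
    \<open>subcritical_cmc_solution_inside\<close>).

  A positive limit of \<open>f\<close> at infinite time forces the velocity and then the acceleration to tend to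
  zero, hence the limit is \<open>c\<close> and \<open>E = E\<^sub>c\<close> (\<open>limit_is_equilibrium\<close>).  Monotone solutions therefore
  have only three fates: they grow beyond all bounds, collapse, or converge to \<open>c\<close> at energy \<open>E\<^sub>c\<close>.

  These cases combine into one comparison (\<open>cmc_trichotomy\<close>).  Let \<open>S l = sgn l * (\<gamma> l - 1)\<close> and
  \<open>C r = sgn (c - r) * (h r - 1)\<close>.  The solution with data \<open>(r, l)\<close> expands, collapses or converges
  according as \<open>S l\<close> is greater than, less than or equal to \<open>C r\<close>.  Since \<open>S\<close> is a strictly
  increasing bijection from \<open>(-1, 1)\<close> onto the line and \<open>C\<close> a strictly decreasing one from
  \<open>(0, \<infinity>)\<close>, the critical data form the graph of a strictly decreasing bijection between radii and
  velocities, and both parts of the theorem follow.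

  Existence, uniqueness and continuation of solutions come from the rapidity \<open>\<theta> = artanh f'\<close>.  In
  the coordinates \<open>(f, \<theta>)\<close> the equation is a first-order system that is globally Lipschitz as soon as
  \<open>f\<close> is kept away from zero, so a solution can only cease to exist where \<open>f\<close> approaches zero.
\<close>

section \<open>Ordinary differential equations with a Lipschitz right-hand side\<close>

text \<open>
  Integration gains the factor \<open>1 / K\<close> in the norm weighted by \<open>exp (- K * \<bar>t\<bar>)\<close>; for large \<open>K\<close> this
  turns the Picard operator into a contraction on the whole line.
\<close>

lemma norm_le_exp_of_derivative_le_exp:
  fixes F :: "real \<Rightarrow> 'a::euclidean_space"
  assumes K: "K > 0"
    and F: "\<And>t. (F has_vector_derivative f t) (at t)"
    and f: "\<And>t. norm (f t) \<le> C * exp (K * \<bar>t\<bar>)"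
    and "F 0 = 0"
  shows "norm (F t) \<le> C / K * exp (K * \<bar>t\<bar>)"
proof -
  have C: "C \<ge> 0"
    using order_trans[OF norm_ge_zero f[of 0]] by simp
  have forward: "norm (G t) \<le> C / K * exp (K * t)"
    if G: "\<And>t. (G has_vector_derivative g t) (at t)"
      and g: "\<And>t. norm (g t) \<le> C * exp (K * \<bar>t\<bar>)" and "G 0 = 0" and "t \<ge> 0"
    for G g :: "real \<Rightarrow> 'a" and t
  proof (cases "t = 0")
    case True
    then show ?thesis using \<open>G 0 = 0\<close> C K by simp
  next
    case False
    have "norm (G t - G 0) \<le> C / K * exp (K * t) - C / K * exp (K * 0)"
    proof (rule differentiable_bound_general)
      show "0 < t" using False \<open>t \<ge> 0\<close> by simp
      show "continuous_on {0..t} G"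
        using G by (meson continuous_at_imp_continuous_on has_vector_derivative_continuous)
      show "continuous_on {0..t} (\<lambda>t. C / K * exp (K * t))"
        by (intro continuous_intros)
      show "(G has_vector_derivative g s) (at s)" for s by (rule G)
      show "((\<lambda>t. C / K * exp (K * t)) has_vector_derivative C * exp (K * s)) (at s)" for s
        unfolding has_real_derivative_iff_has_vector_derivative[symmetric]
        using K by (auto intro!: derivative_eq_intros)
      show "norm (g s) \<le> C * exp (K * s)" if "0 < s" for s
        using g[of s] that by simp
    qed
    moreover have "C / K \<ge> 0" using C K by simp
    ultimately show ?thesis using \<open>G 0 = 0\<close> by simp
  qed
  show ?thesis
  proof (cases "t \<ge> 0")
    case True
    then show ?thesis using forward[OF F f \<open>F 0 = 0\<close>, of t] by simp
  next
    case False
    have "((\<lambda>t. F (- t)) has_vector_derivative - f (- t)) (at t)" for t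
      using vector_diff_chain_at[of uminus "-1" t F "f (- t)"] F[of "- t"]
        has_vector_derivative_minus[OF has_vector_derivative_id[of "at t"]]
      by (simp add: o_def)
    from forward[of "\<lambda>t. F (- t)" "\<lambda>t. - f (- t)" "- t", OF this]
    show ?thesis using f False \<open>F 0 = 0\<close> by (metis abs_minus_cancel minus_zero norm_minus_cancel
          abs_of_nonpos linear minus_minus neg_0_le_iff_le)
  qed
qed

text \<open>
  The Picard operator is a contraction with factor \<open>L / K\<close> in the supremum norm weighted by
  \<open>exp (- K * \<bar>t\<bar>)\<close>, so Banach's theorem yields a solution for all times at once, without patching
  together short time intervals.
\<close>

theorem global_solution_of_lipschitz_ode:
  fixes V :: "'a::euclidean_space \<Rightarrow> 'a"
  assumes V: "L-lipschitz_on UNIV V"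
  shows "\<exists>z. z t0 = z0 \<and> (\<forall>t. (z has_vector_derivative V (z t)) (at t))"
proof -
  define K where "K = 2 * L + 1"
  have L: "L \<ge> 0" using V by (rule lipschitz_on_nonneg)
  then have K: "K > 0" and LK: "L / K \<le> 1 / 2" by (simp_all add: K_def field_simps)
  have Vdist: "norm (V a - V b) \<le> L * norm (a - b)" for a b
    using lipschitz_onD[OF V, of a b] by (simp add: dist_norm)
  have contV: "isCont V a" for a
    using lipschitz_on_continuous_on[OF V] by (simp add: continuous_on_eq_continuous_at)
  \<comment> \<open>A bounded function \<open>y\<close> encodes the curve \<open>exp (K * \<bar>t\<bar>) *\<^sub>R y t\<close>, which may
    grow exponentially.\<close>
  let ?f = "\<lambda>y :: real \<Rightarrow>\<^sub>C 'a. \<lambda>t. V (exp (K * \<bar>t\<bar>) *\<^sub>R apply_bcontfun y t)"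
  have "\<exists>F. F 0 = z0 \<and> (\<forall>t. (F has_vector_derivative ?f y t) (at t))" for y
  proof -
    have "isCont (apply_bcontfun y) t" for t
      using continuous_on_apply_bcontfun[of UNIV y] continuous_on_eq_continuous_at open_UNIV by blast
    then have "isCont (?f y) t" for t
      by (intro isCont_o2[OF _ contV] continuous_intros)
    then obtain F where "\<And>t. (F has_vector_derivative ?f y t) (at t)"
      using einterval_antiderivative[of "- \<infinity>" "\<infinity>" "?f y"] by auto
    then show ?thesis
      by (intro exI[of _ "\<lambda>t. F t - F 0 + z0"]) (auto intro!: derivative_eq_intros)
  qed
  then obtain F where F0: "\<And>y. F y 0 = z0"
    and F: "\<And>y t. (F y has_vector_derivative ?f y t) (at t)" by metis
  define T where "T y = Bcontfun (\<lambda>t. exp (- K * \<bar>t\<bar>) *\<^sub>R F y t)" for y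
  have T: "apply_bcontfun (T y) t = exp (- K * \<bar>t\<bar>) *\<^sub>R F y t" for y t
  proof -
    have "(\<lambda>t. exp (- K * \<bar>t\<bar>) *\<^sub>R F y t) \<in> bcontfun"
    proof (rule bcontfun_normI)
      have "continuous_on UNIV (F y)"
        using F by (meson continuous_at_imp_continuous_on has_vector_derivative_continuous)
      then show "continuous_on UNIV (\<lambda>t. exp (- K * \<bar>t\<bar>) *\<^sub>R F y t)"
        by (intro continuous_intros)
      fix t
      let ?C = "norm (V 0) + L * norm y"
      have "norm (?f y t) \<le> ?C * exp (K * \<bar>t\<bar>)" for t
      proof -
        have "norm (?f y t) \<le> norm (V 0) + norm (?f y t - V 0)" by norm
        also have "\<dots> \<le> norm (V 0) + L * (exp (K * \<bar>t\<bar>) * norm (apply_bcontfun y t))"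
          using Vdist[of "exp (K * \<bar>t\<bar>) *\<^sub>R apply_bcontfun y t" 0] by simp
        also have "\<dots> \<le> norm (V 0) * exp (K * \<bar>t\<bar>) + L * (exp (K * \<bar>t\<bar>) * norm y)"
          using K L norm_bounded[of y t]
          by (intro add_mono mult_left_mono) (auto simp: mult_le_cancel_left1)
        finally show ?thesis by (simp add: algebra_simps)
      qed
      then have "norm (F y t - z0) \<le> ?C / K * exp (K * \<bar>t\<bar>)"
        by (intro norm_le_exp_of_derivative_le_exp[where f = "?f y"] K)
          (use F in \<open>auto intro!: derivative_eq_intros simp: F0\<close>)
      then have "exp (- K * \<bar>t\<bar>) * norm (F y t - z0) \<le> exp (- K * \<bar>t\<bar>) * (?C / K * exp (K * \<bar>t\<bar>))"
        by (intro mult_left_mono) auto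
      also have "\<dots> = ?C / K"
        by (simp add: exp_minus)
      finally have 1: "exp (- K * \<bar>t\<bar>) * norm (F y t - z0) \<le> ?C / K" .
      have 2: "exp (- K * \<bar>t\<bar>) * norm z0 \<le> norm z0"
        using K by (intro mult_left_le_one_le) auto
      have "norm (F y t) \<le> norm (F y t - z0) + norm z0" by norm
      then have "exp (- K * \<bar>t\<bar>) * norm (F y t) \<le> exp (- K * \<bar>t\<bar>) * (norm (F y t - z0) + norm z0)"
        by (intro mult_left_mono) auto
      then show "norm (exp (- K * \<bar>t\<bar>) *\<^sub>R F y t) \<le> ?C / K + norm z0"
        using 1 2 by (simp add: distrib_left)
    qed
    then show ?thesis by (simp add: T_def Bcontfun_inverse)
  qed
  have "dist (T x) (T y) \<le> 1 / 2 * dist x y" for x y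
  proof (rule dist_bound)
    fix t
    have "norm (?f x t - ?f y t) \<le> (L * dist x y) * exp (K * \<bar>t\<bar>)" for t
    proof -
      have "norm (?f x t - ?f y t)
          \<le> L * (exp (K * \<bar>t\<bar>) * norm (apply_bcontfun x t - apply_bcontfun y t))"
        using Vdist[of "exp (K * \<bar>t\<bar>) *\<^sub>R apply_bcontfun x t" "exp (K * \<bar>t\<bar>) *\<^sub>R apply_bcontfun y t"]
        by (simp flip: scaleR_diff_right)
      also have "\<dots> \<le> L * (exp (K * \<bar>t\<bar>) * dist x y)"
        using L dist_bounded[of x t y] by (intro mult_left_mono) (auto simp: dist_norm)
      finally show ?thesis by (simp add: algebra_simps)
    qed
    then have "norm (F x t - F y t) \<le> L * dist x y / K * exp (K * \<bar>t\<bar>)"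
      by (intro norm_le_exp_of_derivative_le_exp[where f = "\<lambda>t. ?f x t - ?f y t"] K)
        (use F in \<open>auto intro!: derivative_eq_intros simp: F0\<close>)
    then have "exp (- K * \<bar>t\<bar>) * norm (F x t - F y t)
        \<le> exp (- K * \<bar>t\<bar>) * (L * dist x y / K * exp (K * \<bar>t\<bar>))"
      by (intro mult_left_mono) auto
    also have "\<dots> = L / K * dist x y"
      by (simp add: exp_minus)
    also have "\<dots> \<le> 1 / 2 * dist x y"
      using LK by (intro mult_right_mono) auto
    finally show "dist (apply_bcontfun (T x) t) (apply_bcontfun (T y) t) \<le> 1 / 2 * dist x y"
      by (simp add: T dist_norm flip: scaleR_diff_right)
  qed
  then obtain y where y: "T y = y"
    using banach_fix_type[of "1/2" T] by auto
  have "exp (K * \<bar>t\<bar>) *\<^sub>R apply_bcontfun y t = F y t" for t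
    using T[of y t] y by (simp add: exp_minus)
  then have "(F y has_vector_derivative V (F y t)) (at t)" for t
    using F[of y t] by simp
  then have "((\<lambda>t. F y (t - t0)) has_vector_derivative V (F y (t - t0))) (at t)" for t
  proof -
    have "((\<lambda>t. t - t0) has_vector_derivative 1) (at t)"
      by (auto intro!: derivative_eq_intros)
    from vector_diff_chain_at[OF this, of "F y"] show ?thesis
      using \<open>\<And>t. (F y has_vector_derivative V (F y t)) (at t)\<close>[of "t - t0"] by (simp add: o_def)
  qed
  then show ?thesis
    by (intro exI[of _ "\<lambda>t. F y (t - t0)"]) (simp add: F0)
qed

text \<open>
  The squared distance \<open>w\<close> of two solutions satisfies \<open>\<bar>w'\<bar> \<le> 2 * L * w\<close>.  Hence \<open>exp (- 2 * L * s) * w s\<close>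
  is nonincreasing and \<open>exp (2 * L * s) * w s\<close> nondecreasing, which keeps a zero of \<open>w\<close> zero in
  both directions of time.
\<close>

theorem lipschitz_ode_unique:
  fixes V :: "'a::euclidean_space \<Rightarrow> 'a"
  assumes V: "L-lipschitz_on UNIV V"
    and x: "\<And>s. s \<in> closed_segment t0 t \<Longrightarrow> (x has_vector_derivative V (x s)) (at s)"
    and y: "\<And>s. s \<in> closed_segment t0 t \<Longrightarrow> (y has_vector_derivative V (y s)) (at s)"
    and "x t0 = y t0"
  shows "x t = y t"
proof -
  let ?D = "\<lambda>s. x s - y s"
  let ?W = "\<lambda>s. V (x s) - V (y s)"
  define w where "w s = ?D s \<bullet> ?D s" for s
  have D: "(w has_real_derivative 2 * (?D s \<bullet> ?W s)) (at s)"
    if "s \<in> closed_segment t0 t" for s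
    unfolding has_real_derivative_iff_has_vector_derivative w_def
    using x[OF that] y[OF that]
    by (auto intro!: derivative_eq_intros
        has_vector_derivative_eq_rhs[OF bounded_bilinear.has_vector_derivative[OF bounded_bilinear_inner]]
        simp: inner_commute)
  have W: "\<bar>?D s \<bullet> ?W s\<bar> \<le> L * w s" for s
  proof -
    have "\<bar>?D s \<bullet> ?W s\<bar> \<le> norm (?D s) * norm (?W s)" by (rule Cauchy_Schwarz_ineq2)
    also have "\<dots> \<le> norm (?D s) * (L * norm (?D s))"
      using lipschitz_onD[OF V, of "x s" "y s"] by (intro mult_left_mono) (auto simp: dist_norm)
    finally show ?thesis by (simp add: w_def dot_square_norm power2_eq_square mult_ac)
  qed
  have "w t \<le> 0"
  proof (cases "t0 \<le> t")
    case True
    have "exp (- 2 * L * t) * w t \<le> exp (- 2 * L * t0) * w t0"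
    proof (rule DERIV_nonpos_imp_nonincreasing[OF True])
      fix s assume "t0 \<le> s" "s \<le> t"
      then have "s \<in> closed_segment t0 t" using True by (simp add: closed_segment_eq_real_ivl)
      then have "((\<lambda>s. exp (- 2 * L * s) * w s) has_real_derivative
          2 * exp (- 2 * L * s) * ((?D s \<bullet> ?W s) - L * w s)) (at s)"
        by (auto intro!: derivative_eq_intros D simp: algebra_simps)
      moreover have "2 * exp (- 2 * L * s) * ((?D s \<bullet> ?W s) - L * w s) \<le> 0"
        using W[of s] by (intro mult_nonneg_nonpos) auto
      ultimately show "\<exists>l. ((\<lambda>s. exp (- 2 * L * s) * w s) has_real_derivative l) (at s) \<and> l \<le> 0"
        by blast
    qed
    then show ?thesis using \<open>x t0 = y t0\<close> by (simp add: w_def mult_le_0_iff)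
  next
    case False
    then have le: "t \<le> t0" by simp
    have "exp (2 * L * t) * w t \<le> exp (2 * L * t0) * w t0"
    proof (rule DERIV_nonneg_imp_nondecreasing[OF le])
      fix s assume "t \<le> s" "s \<le> t0"
      then have "s \<in> closed_segment t0 t" using le by (simp add: closed_segment_eq_real_ivl)
      then have "((\<lambda>s. exp (2 * L * s) * w s) has_real_derivative
          2 * exp (2 * L * s) * ((?D s \<bullet> ?W s) + L * w s)) (at s)"
        by (auto intro!: derivative_eq_intros D simp: algebra_simps)
      moreover have "0 \<le> 2 * exp (2 * L * s) * ((?D s \<bullet> ?W s) + L * w s)"
        using W[of s] by (intro mult_nonneg_nonneg) auto
      ultimately show "\<exists>l. ((\<lambda>s. exp (2 * L * s) * w s) has_real_derivative l) (at s) \<and> l \<ge> 0"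
        by blast
    qed
    then show ?thesis using \<open>x t0 = y t0\<close> by (simp add: w_def mult_le_0_iff)
  qed
  moreover have "w t \<ge> 0" by (simp add: w_def)
  ultimately have "w t = 0" by (rule antisym)
  then show ?thesis by (simp add: w_def)
qed

section \<open>Solutions: locality, existence, uniqueness, continuation\<close>

text \<open>
  The second derivative that the equation prescribes at radius \<open>x\<close> and velocity \<open>v\<close>.
\<close>

definition cmc_acceleration :: "nat \<Rightarrow> real \<Rightarrow> real \<Rightarrow> real" where
  "cmc_acceleration d x v = (1 - v\<^sup>2) * ((real d + 1) * sqrt (1 - v\<^sup>2) - real d / x)"

lemma cmc_equation_iff_acceleration:
  assumes "x > 0" "\<bar>v\<bar> < 1"
  shows "(1 - v\<^sup>2) * real d + x * a = (real d + 1) * (1 - v\<^sup>2) powr (3 / 2) * x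
    \<longleftrightarrow> a = cmc_acceleration d x v"
proof -
  have pos: "1 - v\<^sup>2 > 0" using assms(2) by (simp add: abs_square_less_1)
  have "(1 - v\<^sup>2) powr (3 / 2) = (1 - v\<^sup>2) powr (1 + 1 / 2)" by simp
  also have "\<dots> = (1 - v\<^sup>2) * sqrt (1 - v\<^sup>2)"
    using pos by (simp only: powr_add powr_half_sqrt powr_one)
  finally have "(1 - v\<^sup>2) * real d + x * a - (real d + 1) * (1 - v\<^sup>2) powr (3 / 2) * x
      = (1 - v\<^sup>2) * real d + x * a - (real d + 1) * ((1 - v\<^sup>2) * sqrt (1 - v\<^sup>2)) * x"
    by simp
  also have "\<dots> = x * (a - cmc_acceleration d x v)"
    using assms(1) by (simp add: cmc_acceleration_def field_simps)
  finally have "(1 - v\<^sup>2) * real d + x * a - (real d + 1) * (1 - v\<^sup>2) powr (3 / 2) * x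
      = x * (a - cmc_acceleration d x v)" .
  then show ?thesis using assms(1) by auto
qed

lemma cmc_solutionD:
  assumes "cmc_solution d f J" "t \<in> J"
  shows "f t > 0" "\<bar>deriv f t\<bar> < 1" "(f has_real_derivative deriv f t) (at t)"
    "(deriv f has_real_derivative cmc_acceleration d (f t) (deriv f t)) (at t)"
proof -
  have *: "f differentiable (at t)" "deriv f differentiable (at t)" "f t > 0" "\<bar>deriv f t\<bar> < 1"
    "(1 - (deriv f t)\<^sup>2) * real d + f t * deriv (deriv f) t
          = (real d + 1) * (1 - (deriv f t)\<^sup>2) powr (3 / 2) * f t"
    using assms by (auto simp: cmc_solution_def)
  show "f t > 0" "\<bar>deriv f t\<bar> < 1" by fact+
  show "(f has_real_derivative deriv f t) (at t)"
    using *(1) by (simp add: DERIV_deriv_iff_real_differentiable)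
  have "deriv (deriv f) t = cmc_acceleration d (f t) (deriv f t)"
    using *(5) cmc_equation_iff_acceleration[OF *(3,4)] by simp
  then show "(deriv f has_real_derivative cmc_acceleration d (f t) (deriv f t)) (at t)"
    using *(2) by (simp add: DERIV_deriv_iff_real_differentiable[symmetric])
qed

lemma cmc_solution_open: "cmc_solution d f J \<Longrightarrow> open J"
  and cmc_solution_interval: "cmc_solution d f J \<Longrightarrow> is_interval J"
  by (simp_all add: cmc_solution_def)

lemma cmc_solutionI:
  assumes J: "open J" "is_interval J"
    and f: "\<And>t. t \<in> J \<Longrightarrow> f t > 0" "\<And>t. t \<in> J \<Longrightarrow> \<bar>v t\<bar> < 1"
      "\<And>t. t \<in> J \<Longrightarrow> (f has_real_derivative v t) (at t)"
      "\<And>t. t \<in> J \<Longrightarrow> (v has_real_derivative cmc_acceleration d (f t) (v t)) (at t)"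
  shows "cmc_solution d f J"
  unfolding cmc_solution_def
proof (intro conjI ballI)
  fix t assume t: "t \<in> J"
  have deriv: "deriv f s = v s" if "s \<in> J" for s
    using f(3)[OF that] by (rule DERIV_imp_deriv)
  have v: "(deriv f has_real_derivative cmc_acceleration d (f t) (v t)) (at t)"
    using f(4)[OF t] J(1) t by (rule has_field_derivative_transform_within_open) (simp add: deriv)
  show "f differentiable (at t)" "deriv f differentiable (at t)"
    using f(3)[OF t] v by (auto simp: real_differentiable_def)
  show "f t > 0" "\<bar>deriv f t\<bar> < 1" using f t deriv by auto
  show "(1 - (deriv f t)\<^sup>2) * real d + f t * deriv (deriv f) t
          = (real d + 1) * (1 - (deriv f t)\<^sup>2) powr (3 / 2) * f t"
    using cmc_equation_iff_acceleration[OF f(1)[OF t] f(2)[OF t]] DERIV_imp_deriv[OF v] deriv[OF t] by simp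
qed (use J in auto)

lemma cmc_solution_cong:
  assumes f: "cmc_solution d f J" and eq: "\<And>t. t \<in> J \<Longrightarrow> g t = f t"
  shows "cmc_solution d g J" "t \<in> J \<Longrightarrow> deriv g t = deriv f t"
proof -
  have g: "(g has_real_derivative deriv f t) (at t)" if "t \<in> J" for t
    using cmc_solutionD(3)[OF f that] cmc_solution_open[OF f] that
    by (rule has_field_derivative_transform_within_open) (simp add: eq)
  then show "t \<in> J \<Longrightarrow> deriv g t = deriv f t" by (rule DERIV_imp_deriv)
  show "cmc_solution d g J"
    by (rule cmc_solutionI[where v = "deriv f"])
      (use cmc_solutionD[OF f] cmc_solution_open[OF f] cmc_solution_interval[OF f] g in \<open>auto simp: eq\<close>)
qed

text \<open>
  Being a solution is a local property; the common point \<open>t0\<close> only makes the union an interval.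
\<close>

lemma cmc_solution_Union:
  assumes "\<And>K. K \<in> \<K> \<Longrightarrow> cmc_solution d f K" and "\<And>K. K \<in> \<K> \<Longrightarrow> t0 \<in> K"
  shows "cmc_solution d f (\<Union>\<K>)"
proof -
  have "is_interval (\<Union>\<K>)"
    unfolding is_interval_connected_1 using assms(2)
    by (intro connected_Union) (auto simp flip: is_interval_connected_1 dest: cmc_solution_interval assms(1))
  moreover have "open (\<Union>\<K>)" using assms(1) cmc_solution_open by blast
  ultimately show ?thesis using assms(1) by (fastforce simp: cmc_solution_def)
qed

text \<open>
  The equation in radius and rapidity \<open>\<theta> = artanh f'\<close>, in which the constraint \<open>\<bar>f'\<bar> < 1\<close> disappears.
  Replacing the radius by its maximum with \<open>\<epsilon>\<close> removes the singularity at radius zero and changes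
  nothing where the radius is at least \<open>\<epsilon>\<close>.
\<close>

definition cmc_field :: "nat \<Rightarrow> real \<Rightarrow> real \<times> real \<Rightarrow> real \<times> real" where
  "cmc_field d \<epsilon> z = (tanh (snd z), (real d + 1) / cosh (snd z) - real d / max (fst z) \<epsilon>)"

lemma sqrt_1_minus_tanh_square: "sqrt (1 - (tanh x)\<^sup>2) = 1 / cosh (x :: real)"
proof -
  have "1 - (tanh x)\<^sup>2 = ((cosh x)\<^sup>2 - (sinh x)\<^sup>2) / (cosh x)\<^sup>2"
    by (simp add: tanh_def power_divide diff_divide_distrib)
  also have "\<dots> = (1 / cosh x)\<^sup>2"
    by (simp add: cosh_square_eq[of x] power_divide)
  finally show ?thesis by simp
qed

lemma tanh_artanh_real:
  fixes x :: real
  assumes "\<bar>x\<bar> < 1"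
  shows "tanh (artanh x) = x"
proof -
  have pos: "1 + x > 0" "1 - x > 0" using assms by auto
  have "exp (- 2 * artanh x) = inverse (exp (ln ((1 + x) / (1 - x))))"
    by (simp add: artanh_def exp_minus)
  also have "\<dots> = (1 - x) / (1 + x)" using pos by simp
  finally have "tanh (artanh x) = (1 - (1 - x) / (1 + x)) / (1 + (1 - x) / (1 + x))"
    by (simp only: tanh_real_altdef)
  also have "\<dots> = x" using pos by (simp add: field_simps)
  finally show ?thesis .
qed

lemma lipschitz_on_real_of_derivative:
  fixes g :: "real \<Rightarrow> real"
  assumes "\<And>x. (g has_real_derivative g' x) (at x)" "\<And>x. \<bar>g' x\<bar> \<le> B"
  shows "B-lipschitz_on UNIV g"
proof (rule lipschitz_onI)
  show "dist (g x) (g y) \<le> B * dist x y" for x y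
    using field_differentiable_bound[of UNIV g g' B x y] assms by (simp add: dist_norm)
  show "0 \<le> B" using assms(2)[of 0] by linarith
qed

lemma cmc_field_lipschitz:
  assumes "\<epsilon> > 0"
  shows "\<exists>L. L-lipschitz_on UNIV (cmc_field d \<epsilon>)"
proof -
  have tanh1: "(tanh x)\<^sup>2 < 1" for x :: real
    using tanh_real_bounds[of x] by (simp add: abs_square_less_1 abs_if)
  have "\<bar>1 - (tanh x)\<^sup>2\<bar> \<le> 1" for x :: real using tanh1[of x] by simp
  then have 1: "1-lipschitz_on UNIV (tanh :: real \<Rightarrow> real)"
    by (intro lipschitz_on_real_of_derivative[where g' = "\<lambda>x. 1 - (tanh x)\<^sup>2"])
      (auto intro!: derivative_eq_intros)
  have 2: "1-lipschitz_on UNIV (\<lambda>x :: real. 1 / cosh x)"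
  proof (rule lipschitz_on_real_of_derivative[where g' = "\<lambda>x. - tanh x / cosh x"])
    show "((\<lambda>x. 1 / cosh x) has_real_derivative - tanh x / cosh x) (at x)" for x :: real
      by (auto intro!: derivative_eq_intros simp: tanh_def field_simps power2_eq_square)
    show "\<bar>- tanh x / cosh x\<bar> \<le> 1" for x :: real
    proof -
      have "\<bar>tanh x\<bar> \<le> 1" using tanh_real_bounds[of x] by auto
      then show ?thesis using cosh_real_ge_1[of x] by (simp add: abs_mult divide_le_eq_1)
    qed
  qed
  have 3: "(1 / \<epsilon>\<^sup>2)-lipschitz_on UNIV (\<lambda>x. 1 / max x \<epsilon>)"
  proof (rule lipschitz_onI)
    fix x y :: real
    have e: "max x \<epsilon> \<ge> \<epsilon>" "max y \<epsilon> \<ge> \<epsilon>" by auto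
    then have pos: "max x \<epsilon> * max y \<epsilon> \<ge> \<epsilon>\<^sup>2" "max x \<epsilon> > 0" "max y \<epsilon> > 0"
      using assms by (auto simp: power2_eq_square intro!: mult_mono)
    have "\<bar>1 / max x \<epsilon> - 1 / max y \<epsilon>\<bar> = \<bar>max y \<epsilon> - max x \<epsilon>\<bar> / (max x \<epsilon> * max y \<epsilon>)"
      using pos by (simp add: diff_frac_eq abs_mult)
    also have "\<dots> \<le> \<bar>y - x\<bar> / \<epsilon>\<^sup>2"
      using pos assms by (intro frac_le) auto
    finally show "dist (1 / max x \<epsilon>) (1 / max y \<epsilon>) \<le> 1 / \<epsilon>\<^sup>2 * dist x y"
      by (simp add: dist_real_def abs_minus_commute)
  qed simp
  have c1: "1-lipschitz_on UNIV (fst :: real \<times> real \<Rightarrow> real)"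
    by (rule lipschitz_onI) (simp_all add: dist_fst_le)
  have c2: "1-lipschitz_on UNIV (snd :: real \<times> real \<Rightarrow> real)"
    by (rule lipschitz_onI) (simp_all add: dist_snd_le)
  note T = lipschitz_on_compose2[OF c2 lipschitz_on_subset[OF 1 subset_UNIV]]
  note S = lipschitz_on_cmult_real[OF lipschitz_on_compose2[OF c2 lipschitz_on_subset[OF 2 subset_UNIV]], of "real d + 1"]
  note M = lipschitz_on_cmult_real[OF lipschitz_on_compose2[OF c1 lipschitz_on_subset[OF 3 subset_UNIV]], of "real d"]
  note lipschitz_on_Pair[OF T lipschitz_on_diff[OF S M]]
  then show ?thesis unfolding cmc_field_def by auto
qed

lemma cmc_solution_imp_cmc_field:
  assumes f: "cmc_solution d f J" "t \<in> J" and "f t \<ge> \<epsilon>"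
  shows "((\<lambda>t. (f t, artanh (deriv f t))) has_vector_derivative
    cmc_field d \<epsilon> (f t, artanh (deriv f t))) (at t)"
proof -
  let ?v = "deriv f t"
  note D = cmc_solutionD[OF f]
  have pos: "1 - ?v\<^sup>2 > 0" using D(2) by (simp add: abs_square_less_1)
  have tanh: "tanh (artanh ?v) = ?v"
    using D(2) by (rule tanh_artanh_real)
  have "((\<lambda>t. artanh (deriv f t)) has_real_derivative 1 / (1 - ?v\<^sup>2) * cmc_acceleration d (f t) ?v) (at t)"
    by (rule DERIV_chain2[OF artanh_real_has_field_derivative D(4)]) (use D(2) in auto)
  also have "1 / (1 - ?v\<^sup>2) * cmc_acceleration d (f t) ?v
      = (real d + 1) / cosh (artanh ?v) - real d / f t"
    using pos sqrt_1_minus_tanh_square[of "artanh ?v"] unfolding tanh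
    by (simp add: cmc_acceleration_def)
  finally have "((\<lambda>t. artanh (deriv f t)) has_vector_derivative
      (real d + 1) / cosh (artanh ?v) - real d / f t) (at t)"
    by (simp add: has_real_derivative_iff_has_vector_derivative)
  moreover have "(f has_vector_derivative tanh (artanh ?v)) (at t)"
    using D(3) by (simp add: has_real_derivative_iff_has_vector_derivative tanh)
  ultimately show ?thesis
    using assms(3) by (simp add: cmc_field_def max_absorb1 has_vector_derivative_Pair)
qed

lemma cmc_field_imp_cmc_solution:
  assumes J: "open J" "is_interval J"
    and z: "\<And>t. t \<in> J \<Longrightarrow> (z has_vector_derivative cmc_field d \<epsilon> (z t)) (at t)"
    and ge: "\<And>t. t \<in> J \<Longrightarrow> fst (z t) \<ge> \<epsilon>" and \<epsilon>: "\<epsilon> > 0"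
  shows "cmc_solution d (\<lambda>t. fst (z t)) J"
proof (rule cmc_solutionI[where v = "\<lambda>t. tanh (snd (z t))"])
  fix t assume t: "t \<in> J"
  show "fst (z t) > 0" using ge[OF t] \<epsilon> by simp
  show "\<bar>tanh (snd (z t))\<bar> < 1" using tanh_real_bounds[of "snd (z t)"] by auto
  show "((\<lambda>t. fst (z t)) has_real_derivative tanh (snd (z t))) (at t)"
    using bounded_linear.has_vector_derivative[OF bounded_linear_fst z[OF t]]
    by (simp add: cmc_field_def has_real_derivative_iff_has_vector_derivative)
  have "((\<lambda>t. snd (z t)) has_real_derivative (real d + 1) / cosh (snd (z t)) - real d / fst (z t)) (at t)"
    using bounded_linear.has_vector_derivative[OF bounded_linear_snd z[OF t]] ge[OF t]
    by (simp add: cmc_field_def has_real_derivative_iff_has_vector_derivative max_absorb1)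
  then show "((\<lambda>t. tanh (snd (z t))) has_real_derivative
      cmc_acceleration d (fst (z t)) (tanh (snd (z t)))) (at t)"
    unfolding cmc_acceleration_def sqrt_1_minus_tanh_square
    by (auto intro!: derivative_eq_intros)
qed (use J in auto)

text \<open>
  The radius changes with speed less than \<open>1\<close>, so a solution of the system truncated at \<open>r / 2\<close> stays in the
  region where the truncation is inactive for a time \<open>r / 2\<close>.  This time depends on \<open>r\<close> alone and
  not on the velocity, which is what \<open>maximal_cmc_solution_continues\<close> relies on.
\<close>

lemma cmc_local_existence:
  assumes "r > 0" "\<bar>l\<bar> < 1"
  shows "\<exists>f. cmc_solution d f {s - r / 2<..<s + r / 2} \<and> f s = r \<and> deriv f s = l"
proof -
  define \<epsilon> where "\<epsilon> = r / 2"
  have \<epsilon>: "\<epsilon> > 0" using assms by (simp add: \<epsilon>_def)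
  obtain L where "L-lipschitz_on UNIV (cmc_field d \<epsilon>)"
    using cmc_field_lipschitz[OF \<epsilon>] by blast
  from global_solution_of_lipschitz_ode[OF this]
  obtain z where z0: "z s = (r, artanh l)"
    and z: "\<And>t. (z has_vector_derivative cmc_field d \<epsilon> (z t)) (at t)" by blast
  have dz: "((\<lambda>t. fst (z t)) has_real_derivative tanh (snd (z t))) (at t)" for t
    using bounded_linear.has_vector_derivative[OF bounded_linear_fst z]
    by (simp add: cmc_field_def has_real_derivative_iff_has_vector_derivative)
  have "fst (z t) \<ge> \<epsilon>" if "t \<in> {s - r / 2<..<s + r / 2}" for t
  proof -
    have "\<bar>tanh (snd (z t))\<bar> \<le> 1" for t using tanh_real_bounds[of "snd (z t)"] by auto
    then have "\<bar>fst (z t) - fst (z s)\<bar> \<le> 1 * \<bar>t - s\<bar>"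
      using field_differentiable_bound[of UNIV "\<lambda>t. fst (z t)" "\<lambda>t. tanh (snd (z t))" 1 t s] dz
      by simp
    then show ?thesis using that by (auto simp: z0 \<epsilon>_def)
  qed
  then have "cmc_solution d (\<lambda>t. fst (z t)) {s - r / 2<..<s + r / 2}"
    by (intro cmc_field_imp_cmc_solution[OF _ _ z _ \<epsilon>]) (auto simp: is_interval_oo)
  moreover have "deriv (\<lambda>t. fst (z t)) s = l"
    using DERIV_imp_deriv[OF dz[of s]] assms(2) by (simp add: z0 tanh_artanh_real)
  ultimately show ?thesis
    by (intro exI[of _ "\<lambda>t. fst (z t)"]) (simp add: z0)
qed

text \<open>
  On the compact segment between \<open>t0\<close> and \<open>t\<close> both solutions stay above a common \<open>\<epsilon> > 0\<close>, so both
  solve the truncated system there.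
\<close>

lemma cmc_unique:
  assumes f: "cmc_solution d f J" and g: "cmc_solution d g K"
    and t0: "t0 \<in> J" "t0 \<in> K" and data: "f t0 = g t0" "deriv f t0 = deriv g t0"
    and t: "t \<in> J" "t \<in> K"
  shows "f t = g t" "deriv f t = deriv g t"
proof -
  let ?S = "closed_segment t0 t"
  have SJ: "?S \<subseteq> J" and SK: "?S \<subseteq> K"
    using cmc_solution_interval[OF f] cmc_solution_interval[OF g] t0 t
    by (auto simp: is_interval_convex_1 closed_segment_subset)
  have "\<exists>\<epsilon>>0. \<forall>s\<in>?S. h s \<ge> \<epsilon>" if "cmc_solution d h I" "?S \<subseteq> I" for h I
  proof -
    have "continuous_on ?S h"
      using cmc_solutionD(3)[OF that(1)] that(2)
      by (meson DERIV_isCont continuous_at_imp_continuous_on subsetD)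
    then obtain s where "s \<in> ?S" "\<forall>s'\<in>?S. h s \<le> h s'"
      using continuous_attains_inf[of ?S h] by auto
    then show ?thesis using cmc_solutionD(1)[OF that(1)] that(2) by blast
  qed
  from this[OF f SJ] this[OF g SK] obtain \<epsilon>1 \<epsilon>2 where
    e: "\<epsilon>1 > 0" "\<And>s. s \<in> ?S \<Longrightarrow> f s \<ge> \<epsilon>1" "\<epsilon>2 > 0" "\<And>s. s \<in> ?S \<Longrightarrow> g s \<ge> \<epsilon>2" by blast
  define \<epsilon> where "\<epsilon> = min \<epsilon>1 \<epsilon>2"
  have "\<epsilon> > 0" using e by (simp add: \<epsilon>_def)
  then obtain L where "L-lipschitz_on UNIV (cmc_field d \<epsilon>)"
    using cmc_field_lipschitz by blast
  then have "(f t, artanh (deriv f t)) = (g t, artanh (deriv g t))"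
  proof (rule lipschitz_ode_unique[where ?t0.0 = t0 and t = t
        and x = "\<lambda>t. (f t, artanh (deriv f t))" and y = "\<lambda>t. (g t, artanh (deriv g t))"])
    fix s assume s: "s \<in> ?S"
    show "((\<lambda>t. (f t, artanh (deriv f t))) has_vector_derivative
        cmc_field d \<epsilon> (f s, artanh (deriv f s))) (at s)"
      by (rule cmc_solution_imp_cmc_field[OF f]) (use SJ s e(2)[OF s] in \<open>auto simp: \<epsilon>_def\<close>)
    show "((\<lambda>t. (g t, artanh (deriv g t))) has_vector_derivative
        cmc_field d \<epsilon> (g s, artanh (deriv g s))) (at s)"
      by (rule cmc_solution_imp_cmc_field[OF g]) (use SK s e(4)[OF s] in \<open>auto simp: \<epsilon>_def\<close>)
  qed (simp add: data)
  then have "f t = g t" "tanh (artanh (deriv f t)) = tanh (artanh (deriv g t))" by auto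
  then show "f t = g t" "deriv f t = deriv g t"
    by (simp_all only: tanh_artanh_real cmc_solutionD(2)[OF f t(1)] cmc_solutionD(2)[OF g t(2)])
qed

lemma cmc_glue:
  assumes f: "cmc_solution d f J" and g: "cmc_solution d g K"
    and t0: "t0 \<in> J" "t0 \<in> K" and data: "f t0 = g t0" "deriv f t0 = deriv g t0"
  shows "cmc_solution d (\<lambda>t. if t \<in> J then f t else g t) (J \<union> K)"
proof -
  let ?h = "\<lambda>t. if t \<in> J then f t else g t"
  have "cmc_solution d ?h J" by (rule cmc_solution_cong(1)[OF f]) simp
  moreover have "cmc_solution d ?h K"
    by (rule cmc_solution_cong(1)[OF g]) (simp add: cmc_unique(1)[OF f g t0 data])
  ultimately have "cmc_solution d ?h (\<Union>{J, K})"
    by (intro cmc_solution_Union[where ?t0.0 = t0]) (use t0 in auto)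
  then show ?thesis by simp
qed

text \<open>
  By uniqueness all solutions with the given data agree wherever they are defined together, so their
  union is a solution; it contains every other solution with these data.
\<close>

theorem maximal_cmc_solution_exists:
  assumes "r > 0" "\<bar>l\<bar> < 1"
  shows "\<exists>f J. maximal_cmc_solution_with_data d t0 r l f J"
proof -
  define \<S> where "\<S> = {(g, K). cmc_solution d g K \<and> t0 \<in> K \<and> g t0 = r \<and> deriv g t0 = l}"
  define J where "J = \<Union>(snd ` \<S>)"
  define f where "f t = fst (SOME p. p \<in> \<S> \<and> t \<in> snd p) t" for t
  have f: "f t = g t" if "(g, K) \<in> \<S>" "t \<in> K" for g K t
  proof -
    have "\<exists>p. p \<in> \<S> \<and> t \<in> snd p" using that by force
    note some = someI_ex[OF this]
    obtain g' K' where p: "(SOME p. p \<in> \<S> \<and> t \<in> snd p) = (g', K')"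
      by (rule prod.exhaust)
    have g': "(g', K') \<in> \<S>" "t \<in> K'" "f t = g' t"
      using some unfolding f_def p by auto
    have "g' t = g t"
      by (rule cmc_unique(1)[of d g' K' g K t0]) (use that g' in \<open>simp_all add: \<S>_def\<close>)
    then show ?thesis using g' by simp
  qed
  have fK: "cmc_solution d f K" "deriv f t0 = l" "f t0 = r" if "(g, K) \<in> \<S>" for g K
  proof -
    from that have g: "cmc_solution d g K" "t0 \<in> K" "g t0 = r" "deriv g t0 = l"
      by (auto simp: \<S>_def)
    show "cmc_solution d f K" by (rule cmc_solution_cong(1)[OF g(1) f[OF that]])
    show "deriv f t0 = l" using cmc_solution_cong(2)[OF g(1) f[OF that] g(2)] g(4) by simp
    show "f t0 = r" using f[OF that g(2)] g(3) by simp
  qed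
  obtain g where "cmc_solution d g {t0 - r / 2<..<t0 + r / 2}" "g t0 = r" "deriv g t0 = l"
    using cmc_local_existence[OF assms, of d t0] by blast
  then have g: "(g, {t0 - r / 2<..<t0 + r / 2}) \<in> \<S>" using assms(1) by (simp add: \<S>_def)
  have data: "f t0 = r" "deriv f t0 = l" by (rule fK[OF g])+
  have t0: "t0 \<in> J" using UN_I[OF g, of t0 snd] assms(1) by (simp add: J_def)
  have sol: "cmc_solution d f J"
    unfolding J_def
  proof (rule cmc_solution_Union[where ?t0.0 = t0])
    fix K assume "K \<in> snd ` \<S>"
    then obtain g where "(g, K) \<in> \<S>" by force
    then show "cmc_solution d f K" "t0 \<in> K" using fK(1) by (simp_all add: \<S>_def)
  qed
  have "K = J" if g: "cmc_solution d g K" "J \<subseteq> K" "\<forall>t\<in>J. g t = f t" for g K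
  proof -
    have "deriv g t0 = deriv f t0"
      using cmc_solution_cong(2)[OF sol _ t0] g(3) by blast
    then have "(g, K) \<in> \<S>" using g data t0 by (auto simp: \<S>_def)
    then have "K \<subseteq> J" unfolding J_def by force
    then show ?thesis using g(2) by blast
  qed
  then have "maximal_cmc_solution d f J" using sol unfolding maximal_cmc_solution_def by blast
  then show ?thesis using data t0 unfolding maximal_cmc_solution_with_data_def by blast
qed

lemma less_Sup_of_open:
  fixes J :: "real set"
  assumes "open J" "bdd_above J" "t \<in> J"
  shows "t < Sup J"
proof -
  obtain e where e: "e > 0" "cball t e \<subseteq> J"
    using assms open_contains_cball by blast
  then have "t + e \<in> J" by (auto simp: dist_real_def)
  then have "t + e \<le> Sup J" using assms(2) by (rule cSup_upper)
  then show ?thesis using e by simp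
qed

text \<open>
  As long as the radius is at least \<open>\<epsilon>\<close>, a solution can be restarted for a time \<open>\<epsilon> / 2\<close>.  Doing this
  closer than \<open>\<epsilon> / 2\<close> to a finite end of \<open>J\<close> would lead beyond that end.
\<close>

lemma maximal_cmc_solution_continues:
  assumes f: "maximal_cmc_solution d f J" and "t0 \<in> J" "\<epsilon> > 0"
    and ge: "\<And>t. t \<in> J \<Longrightarrow> t \<ge> t0 \<Longrightarrow> f t \<ge> \<epsilon>"
  shows "{t0..} \<subseteq> J"
proof (rule ccontr)
  assume "\<not> {t0..} \<subseteq> J"
  then obtain b where b: "b \<ge> t0" "b \<notin> J" by auto
  have sol: "cmc_solution d f J" using f unfolding maximal_cmc_solution_def by blast
  have J: "t \<in> J" if "a \<in> J" "c \<in> J" "a \<le> t" "t \<le> c" for a t c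
    using cmc_solution_interval[OF sol] that unfolding is_interval_1 by blast
  have "t \<le> b" if "t \<in> J" for t
    using J[of t0 t b] \<open>t0 \<in> J\<close> b that by linarith
  then have bdd: "bdd_above J" by (rule bdd_aboveI)
  define T where "T = Sup J"
  have "t0 \<le> T" unfolding T_def using \<open>t0 \<in> J\<close> bdd by (rule cSup_upper)
  have "T \<notin> J"
    using less_Sup_of_open[OF cmc_solution_open[OF sol] bdd] by (force simp: T_def)
  then have "t0 < T" using \<open>t0 \<le> T\<close> \<open>t0 \<in> J\<close> by (cases "t0 = T") auto
  then have "max t0 (T - \<epsilon> / 2) < Sup J" using \<open>\<epsilon> > 0\<close> by (simp add: T_def)
  then obtain s where s: "s \<in> J" "max t0 (T - \<epsilon> / 2) < s"
    using less_cSup_iff[of J] \<open>t0 \<in> J\<close> bdd by blast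
  then have "f s \<ge> \<epsilon>" "s \<le> T" using ge[of s] cSup_upper[OF s(1) bdd] by (auto simp: T_def)
  obtain g where g: "cmc_solution d g {s - f s / 2<..<s + f s / 2}" "g s = f s" "deriv g s = deriv f s"
    using cmc_local_existence[of "f s" "deriv f s" d s] cmc_solutionD(1,2)[OF sol s(1)] by blast
  let ?K = "{s - f s / 2<..<s + f s / 2}"
  define h where "h t = (if t \<in> J then f t else g t)" for t
  have "s \<in> ?K" using cmc_solutionD(1)[OF sol s(1)] by simp
  from cmc_glue[OF sol g(1) s(1) this g(2)[symmetric] g(3)[symmetric]]
  have "cmc_solution d h (J \<union> ?K)" by (simp only: h_def[abs_def])
  moreover have "\<forall>t\<in>J. h t = f t" by (simp add: h_def)
  ultimately have "J \<union> ?K = J"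
    using f Un_upper1 unfolding maximal_cmc_solution_def by blast
  moreover have "T \<in> ?K" using s \<open>s \<le> T\<close> \<open>f s \<ge> \<epsilon>\<close> \<open>\<epsilon> > 0\<close> by simp
  ultimately show False using \<open>T \<notin> J\<close> by blast
qed

section \<open>The energy and the critical Lorentz factor\<close>

definition cmc_radius :: "nat \<Rightarrow> real" where
  "cmc_radius d = real d / (real d + 1)"

definition lorentz_factor :: "real \<Rightarrow> real" where
  "lorentz_factor v = 1 / sqrt (1 - v\<^sup>2)"

text \<open>
  The first integral of the equation, see \<open>cmc_energy_constant\<close>.
\<close>

definition cmc_energy :: "nat \<Rightarrow> real \<Rightarrow> real \<Rightarrow> real" where
  "cmc_energy d x v = x ^ d * (lorentz_factor v - x)"

definition critical_energy :: "nat \<Rightarrow> real" where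
  "critical_energy d = cmc_radius d ^ d * (1 - cmc_radius d)"

text \<open>
  The Lorentz factor that a solution with the energy of the static solution has at radius \<open>x\<close>.  The
  form uses \<open>critical_energy d / x ^ d = (1 - c) * (c / x) ^ d\<close> with \<open>c = cmc_radius d\<close>.
\<close>

definition critical_lorentz_factor :: "nat \<Rightarrow> real \<Rightarrow> real" where
  "critical_lorentz_factor d x = x + (1 - cmc_radius d) * (cmc_radius d / x) ^ d"

lemma cmc_radius_bounds: "d \<ge> 1 \<Longrightarrow> 0 < cmc_radius d" "cmc_radius d < 1"
  by (simp_all add: cmc_radius_def)

lemma one_minus_square_pos: "\<bar>v\<bar> < 1 \<Longrightarrow> 1 - v\<^sup>2 > (0 :: real)"
  by (simp add: abs_square_less_1)

lemma lorentz_factor_ge_1: "\<bar>v\<bar> < 1 \<Longrightarrow> lorentz_factor v \<ge> 1"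
  using one_minus_square_pos[of v] by (simp add: lorentz_factor_def)

lemma lorentz_factor_0 [simp]: "lorentz_factor 0 = 1"
  by (simp add: lorentz_factor_def)

lemma square_eq_lorentz_factor: "\<bar>v\<bar> < 1 \<Longrightarrow> v\<^sup>2 = 1 - 1 / (lorentz_factor v)\<^sup>2"
  using one_minus_square_pos[of v] by (simp add: lorentz_factor_def power_divide)

lemma lorentz_factor_eq_1_iff: "\<bar>v\<bar> < 1 \<Longrightarrow> lorentz_factor v = 1 \<longleftrightarrow> v = 0"
  using square_eq_lorentz_factor[of v] by auto

lemma lorentz_factor_less:
  assumes "\<bar>u\<bar> < \<bar>v\<bar>" "\<bar>v\<bar> < 1"
  shows "lorentz_factor u < lorentz_factor v"
proof -
  have "u\<^sup>2 < v\<^sup>2" using power_strict_mono[OF assms(1), of 2] by simp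
  then show ?thesis
    using one_minus_square_pos[OF assms(2)] by (simp add: lorentz_factor_def frac_less2)
qed

lemma cmc_energy_minus_critical:
  assumes "x > 0"
  shows "cmc_energy d x v - critical_energy d = x ^ d * (lorentz_factor v - critical_lorentz_factor d x)"
proof -
  have "x ^ d * ((1 - cmc_radius d) * (cmc_radius d / x) ^ d) = critical_energy d"
    using assms by (simp add: critical_energy_def power_divide)
  then show ?thesis
    by (simp add: cmc_energy_def critical_lorentz_factor_def algebra_simps)
qed

lemma cmc_energy_critical_iff:
  assumes "x > 0"
  shows "cmc_energy d x v < critical_energy d \<longleftrightarrow> lorentz_factor v < critical_lorentz_factor d x"
    "cmc_energy d x v = critical_energy d \<longleftrightarrow> lorentz_factor v = critical_lorentz_factor d x"
    "cmc_energy d x v > critical_energy d \<longleftrightarrow> lorentz_factor v > critical_lorentz_factor d x"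
proof -
  have "cmc_energy d x v < critical_energy d \<longleftrightarrow> x ^ d * (lorentz_factor v - critical_lorentz_factor d x) < 0"
    "cmc_energy d x v = critical_energy d \<longleftrightarrow> x ^ d * (lorentz_factor v - critical_lorentz_factor d x) = 0"
    "cmc_energy d x v > critical_energy d \<longleftrightarrow> x ^ d * (lorentz_factor v - critical_lorentz_factor d x) > 0"
    using cmc_energy_minus_critical[OF assms, of d v] by linarith+
  then show "cmc_energy d x v < critical_energy d \<longleftrightarrow> lorentz_factor v < critical_lorentz_factor d x"
    "cmc_energy d x v = critical_energy d \<longleftrightarrow> lorentz_factor v = critical_lorentz_factor d x"
    "cmc_energy d x v > critical_energy d \<longleftrightarrow> lorentz_factor v > critical_lorentz_factor d x"
    using assms by (auto simp: mult_less_0_iff zero_less_mult_iff)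
qed

text \<open>
  The identity \<open>d * (1 - c) = c\<close> for \<open>c = cmc_radius d\<close> collapses the derivative to a form whose sign
  changes exactly at \<open>c\<close>.
\<close>

lemma critical_lorentz_factor_has_derivative:
  assumes "x > 0"
  shows "(critical_lorentz_factor d has_real_derivative 1 - (cmc_radius d / x) ^ (d + 1)) (at x)"
proof -
  let ?c = "cmc_radius d"
  have c: "real d * (1 - ?c) = ?c" by (simp add: cmc_radius_def field_simps)
  have pow: "real d * y ^ (d - 1) * y = real d * y ^ d" for y :: real by (cases d) auto
  have "((\<lambda>x. x + (1 - ?c) * (?c / x) ^ d) has_real_derivative
      1 + (1 - ?c) * (real d * (?c / x) ^ (d - 1) * (- ?c / x\<^sup>2))) (at x)"
    using assms by (auto intro!: derivative_eq_intros simp: power2_eq_square)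
  also have "(1 - ?c) * (real d * (?c / x) ^ (d - 1) * (- ?c / x\<^sup>2))
      = - ((1 - ?c) * (real d * (?c / x) ^ (d - 1) * (?c / x)) / x)"
    by (simp add: power2_eq_square)
  also have "\<dots> = - (real d * (1 - ?c) * (?c / x) ^ d / x)" unfolding pow by simp
  also have "\<dots> = - ((?c / x) ^ (d + 1))" unfolding c by simp
  finally show ?thesis
    by (simp add: critical_lorentz_factor_def[abs_def])
qed

lemma critical_lorentz_factor_less:
  assumes "d \<ge> 1"
  shows "0 < x \<Longrightarrow> x < y \<Longrightarrow> y \<le> cmc_radius d \<Longrightarrow> critical_lorentz_factor d y < critical_lorentz_factor d x"
    and "cmc_radius d \<le> x \<Longrightarrow> x < y \<Longrightarrow> critical_lorentz_factor d x < critical_lorentz_factor d y"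
proof -
  note c = cmc_radius_bounds(1)[OF assms]
  note D = critical_lorentz_factor_has_derivative[of _ d]
  show "critical_lorentz_factor d y < critical_lorentz_factor d x" if "0 < x" "x < y" "y \<le> cmc_radius d"
  proof (rule DERIV_neg_imp_decreasing_open[OF \<open>x < y\<close>])
    show "\<exists>l. (critical_lorentz_factor d has_real_derivative l) (at s) \<and> l < 0" if "x < s" "s < y" for s
    proof -
      have "1 < (cmc_radius d / s) ^ (d + 1)"
        using that \<open>0 < x\<close> \<open>y \<le> cmc_radius d\<close> by (intro one_less_power) auto
      then show ?thesis using D[of s] that \<open>0 < x\<close> by force
    qed
    show "continuous_on {x..y} (critical_lorentz_factor d)"
      using DERIV_isCont[OF D] \<open>0 < x\<close> by (intro continuous_at_imp_continuous_on) auto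
  qed
  show "critical_lorentz_factor d x < critical_lorentz_factor d y" if "cmc_radius d \<le> x" "x < y"
  proof (rule DERIV_pos_imp_increasing_open[OF \<open>x < y\<close>])
    show "\<exists>l. (critical_lorentz_factor d has_real_derivative l) (at s) \<and> l > 0" if "x < s" "s < y" for s
    proof -
      have "(cmc_radius d / s) ^ (d + 1) < 1"
        using that c \<open>cmc_radius d \<le> x\<close> by (intro power_less_one_iff[THEN iffD2]) auto
      then show ?thesis using D[of s] that c \<open>cmc_radius d \<le> x\<close> by force
    qed
    show "continuous_on {x..y} (critical_lorentz_factor d)"
      using DERIV_isCont[OF D] c \<open>cmc_radius d \<le> x\<close> by (intro continuous_at_imp_continuous_on) auto
  qed
qed

lemma critical_lorentz_factor_at_radius:
  assumes "d \<ge> 1"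
  shows "critical_lorentz_factor d (cmc_radius d) = 1"
  using cmc_radius_bounds(1)[OF assms] by (simp add: critical_lorentz_factor_def)

lemma critical_lorentz_factor_gt_1:
  assumes "d \<ge> 1" "x > 0" "x \<noteq> cmc_radius d"
  shows "critical_lorentz_factor d x > 1"
  using critical_lorentz_factor_less[OF assms(1), of x "cmc_radius d"]
    critical_lorentz_factor_less[OF assms(1), of "cmc_radius d" x]
    critical_lorentz_factor_at_radius[OF assms(1)] assms by linarith

lemma critical_lorentz_factor_ge_1:
  assumes "d \<ge> 1" "x > 0"
  shows "critical_lorentz_factor d x \<ge> 1"
  using critical_lorentz_factor_gt_1[OF assms] critical_lorentz_factor_at_radius[OF assms(1)]
  by (cases "x = cmc_radius d") auto

lemma cmc_acceleration_eq:
  assumes "\<bar>v\<bar> < 1"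
  shows "cmc_acceleration d x v = (1 - v\<^sup>2) * ((real d + 1) / lorentz_factor v - real d / x)"
  using one_minus_square_pos[OF assms] by (simp add: cmc_acceleration_def lorentz_factor_def)

lemma cmc_acceleration_sign:
  assumes "x > 0" "\<bar>v\<bar> < 1"
  shows "cmc_acceleration d x v > 0 \<longleftrightarrow> x > cmc_radius d * lorentz_factor v"
    "cmc_acceleration d x v < 0 \<longleftrightarrow> x < cmc_radius d * lorentz_factor v"
proof -
  let ?g = "lorentz_factor v"
  have g: "?g > 0" using lorentz_factor_ge_1[OF assms(2)] by simp
  define A where "A = (1 - v\<^sup>2) * ((real d + 1) / (?g * x))"
  have "(real d + 1) / ?g - real d / x = (real d + 1) / (?g * x) * (x - cmc_radius d * ?g)"
  proof -
    have "(real d + 1) * (x - cmc_radius d * ?g) = (real d + 1) * x - real d * ?g"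
      by (simp add: cmc_radius_def right_diff_distrib)
    then have "(real d + 1) / (?g * x) * (x - cmc_radius d * ?g) = ((real d + 1) * x - real d * ?g) / (?g * x)"
      by simp
    also have "\<dots> = (real d + 1) / ?g - real d / x"
      using g assms(1) by (simp add: field_simps)
    finally show ?thesis by simp
  qed
  then have eq: "cmc_acceleration d x v = A * (x - cmc_radius d * ?g)"
    unfolding cmc_acceleration_eq[OF assms(2)] A_def by simp
  have "A > 0"
    unfolding A_def using one_minus_square_pos[OF assms(2)] g assms(1)
    by (intro divide_pos_pos mult_pos_pos) auto
  then show "cmc_acceleration d x v > 0 \<longleftrightarrow> x > cmc_radius d * lorentz_factor v"
    "cmc_acceleration d x v < 0 \<longleftrightarrow> x < cmc_radius d * lorentz_factor v"
    unfolding eq by (simp_all add: zero_less_mult_iff mult_less_0_iff)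
qed

text \<open>
  By the energy bound, \<open>\<gamma> \<le> h x \<le> x + (1 - c)\<close> for \<open>x > c\<close>, and therefore
  \<open>c * \<gamma> \<le> c * x + c * (1 - c) < x\<close>, which is the condition in \<open>cmc_acceleration_sign\<close>.
\<close>

lemma cmc_acceleration_pos_outside:
  assumes "d \<ge> 1" "x > cmc_radius d" "\<bar>v\<bar> < 1" "cmc_energy d x v \<le> critical_energy d"
  shows "cmc_acceleration d x v > 0"
proof -
  let ?c = "cmc_radius d"
  note c = cmc_radius_bounds(1)[OF assms(1)] cmc_radius_bounds(2)[of d]
  have x: "x > 0" using assms(2) c by simp
  have "(?c / x) ^ d \<le> 1" using c assms(2) by (intro power_le_one) auto
  then have "(1 - ?c) * (?c / x) ^ d \<le> 1 - ?c"
    using c by (intro mult_left_le) auto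
  then have "lorentz_factor v \<le> x + (1 - ?c)"
    using assms(4) cmc_energy_critical_iff(3)[OF x, of d v] by (simp add: critical_lorentz_factor_def not_less)
  then have "?c * lorentz_factor v \<le> ?c * (x + (1 - ?c))"
    using c by (intro mult_left_mono) auto
  also have "\<dots> < ?c * x + x * (1 - ?c)"
    using c assms(2) by (simp add: distrib_left)
  finally show ?thesis
    using cmc_acceleration_sign(1)[OF x assms(3)] by (simp add: algebra_simps)
qed

text \<open>
  Inside the critical radius, \<open>\<gamma> \<ge> 1\<close> already gives \<open>x < c * \<gamma>\<close>.
\<close>

lemma cmc_acceleration_neg_inside:
  assumes "0 < x" "x < cmc_radius d" "\<bar>v\<bar> < 1"
  shows "cmc_acceleration d x v < 0"
proof -
  have "x < cmc_radius d * 1" using assms by simp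
  also have "\<dots> \<le> cmc_radius d * lorentz_factor v"
    using lorentz_factor_ge_1[OF assms(3)] assms by (intro mult_left_mono) auto
  finally show ?thesis using cmc_acceleration_sign(2)[OF assms(1,3)] by simp
qed

lemma lorentz_factor_has_derivative:
  assumes "\<bar>v\<bar> < 1"
  shows "(lorentz_factor has_real_derivative lorentz_factor v * v / (1 - v\<^sup>2)) (at v)"
  using one_minus_square_pos[OF assms] unfolding lorentz_factor_def[abs_def]
  by (auto intro!: derivative_eq_intros simp: field_simps)

text \<open>
  Along a solution \<open>\<gamma>' = f' * (d + 1 - d * \<gamma> / f)\<close>; inserting this into the derivative of
  \<open>f ^ d * (\<gamma> - f)\<close> cancels all terms.
\<close>

lemma cmc_energy_constant:
  assumes f: "cmc_solution d f J" and s: "s \<in> J" and t: "t \<in> J"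
  shows "cmc_energy d (f s) (deriv f s) = cmc_energy d (f t) (deriv f t)"
proof -
  have "((\<lambda>t. cmc_energy d (f t) (deriv f t)) has_real_derivative 0) (at t)" if "t \<in> J" for t
  proof -
    note D = cmc_solutionD[OF f that]
    let ?v = "deriv f t" and ?g = "lorentz_factor (deriv f t)"
    note pos = one_minus_square_pos[OF D(2)]
    have g: "?g > 0" using lorentz_factor_ge_1[OF D(2)] by simp
    have "((\<lambda>t. lorentz_factor (deriv f t)) has_real_derivative
        ?g * ?v / (1 - ?v\<^sup>2) * cmc_acceleration d (f t) ?v) (at t)"
      by (rule DERIV_chain2[OF lorentz_factor_has_derivative[OF D(2)] D(4)])
    also have "?g * ?v / (1 - ?v\<^sup>2) * cmc_acceleration d (f t) ?v
        = ?v * (real d + 1 - real d * ?g / f t)"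
      using D(1) g pos unfolding cmc_acceleration_eq[OF D(2)]
      by (simp add: right_diff_distrib)
    finally have G: "((\<lambda>t. lorentz_factor (deriv f t)) has_real_derivative
        ?v * (real d + 1 - real d * ?g / f t)) (at t)" .
    have P: "((\<lambda>t. f t ^ d) has_real_derivative real d * f t ^ d / f t * ?v) (at t)"
    proof -
      have "real d * f t ^ (d - 1) = real d * f t ^ d / f t"
        using D(1) by (cases d) auto
      moreover have "((\<lambda>t. f t ^ d) has_real_derivative real d * f t ^ (d - 1) * ?v) (at t)"
        using DERIV_power[OF D(3), of d] by (simp add: mult_ac)
      ultimately show ?thesis by (simp only:)
    qed
    have "((\<lambda>t. f t ^ d * (lorentz_factor (deriv f t) - f t)) has_real_derivative
      (real d * f t ^ d / f t * ?v * (?g - f t) + (?v * (real d + 1 - real d * ?g / f t) - ?v) * f t ^ d)) (at t)"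
      by (intro derivative_intros DERIV_mult DERIV_diff P G D(3))
    also have "real d * f t ^ d / f t * ?v * (?g - f t) + (?v * (real d + 1 - real d * ?g / f t) - ?v) * f t ^ d = 0"
      using D(1) by (simp add: field_simps)
    finally show ?thesis by (simp add: cmc_energy_def)
  qed
  moreover have "convex J"
    using cmc_solution_interval[OF f] by (simp add: is_interval_convex_1)
  ultimately obtain C where "\<forall>t\<in>J. cmc_energy d (f t) (deriv f t) = C"
    using has_field_derivative_zero_constant[of J "\<lambda>t. cmc_energy d (f t) (deriv f t)"]
    by (meson has_field_derivative_at_within)
  then show ?thesis using s t by simp
qed

lemma cmc_solution_constant:
  assumes "d \<ge> 1"
  shows "cmc_solution d (\<lambda>_. cmc_radius d) UNIV"
proof (rule cmc_solutionI[where v = "\<lambda>_. 0"])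
  have "cmc_acceleration d (cmc_radius d) 0 = 0"
    using assms by (simp add: cmc_acceleration_def cmc_radius_def)
  then show "((\<lambda>_. 0) has_real_derivative cmc_acceleration d (cmc_radius d) 0) (at t)" for t
    by simp
qed (use cmc_radius_bounds(1)[OF assms] in auto)

section \<open>The possible fates of a monotone solution\<close>

text \<open>
  By the mean value theorem the increment of \<open>g\<close> over \<open>[t, t + 1]\<close>, which tends to zero, is a value of
  the derivative at a point that tends to infinity with \<open>t\<close>.  The square is used because the energy
  determines the velocity only up to its sign.
\<close>

lemma derivative_square_limit_zero:
  fixes g :: "real \<Rightarrow> real"
  assumes D: "\<And>t. t \<ge> a \<Longrightarrow> (g has_real_derivative g' t) (at t)"
    and g: "(g \<longlongrightarrow> L) at_top" and g': "((\<lambda>t. (g' t)\<^sup>2) \<longlongrightarrow> m) at_top"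
  shows "m = 0"
proof -
  have "\<exists>\<xi>. t \<le> \<xi> \<and> (a \<le> t \<longrightarrow> g (t + 1) - g t = g' \<xi>)" for t
  proof (cases "a \<le> t")
    case True
    then obtain z where "t < z" "g (t + 1) - g t = (t + 1 - t) * g' z"
      using MVT2[of t "t + 1" g g'] D by auto
    then show ?thesis by (intro exI[of _ z]) simp
  qed auto
  then obtain \<xi> where \<xi>: "\<And>t. t \<le> \<xi> t" "\<And>t. a \<le> t \<Longrightarrow> g (t + 1) - g t = g' (\<xi> t)" by metis
  have "filterlim \<xi> at_top at_top"
    by (rule filterlim_at_top_mono[OF filterlim_ident]) (simp add: \<xi>(1))
  from filterlim_compose[OF g' this] have 1: "((\<lambda>t. (g' (\<xi> t))\<^sup>2) \<longlongrightarrow> m) at_top" .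
  have "filterlim (\<lambda>t :: real. t + 1) at_top at_top"
    by (rule filterlim_at_top_mono[OF filterlim_ident]) simp
  from filterlim_compose[OF g this] have "((\<lambda>t. (g (t + 1) - g t)\<^sup>2) \<longlongrightarrow> (L - L)\<^sup>2) at_top"
    by (intro tendsto_intros g)
  moreover have "eventually (\<lambda>t. (g (t + 1) - g t)\<^sup>2 = (g' (\<xi> t))\<^sup>2) at_top"
    using eventually_ge_at_top[of a] by eventually_elim (simp add: \<xi>(2))
  ultimately have "((\<lambda>t. (g' (\<xi> t))\<^sup>2) \<longlongrightarrow> 0) at_top"
    by (simp add: filterlim_cong)
  with 1 show ?thesis by (rule tendsto_unique[OF trivial_limit_at_top_linorder])
qed

text \<open>
  Conservation of energy makes the Lorentz factor, hence the squared velocity, converge together with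
  the radius, and \<open>derivative_square_limit_zero\<close> forces the velocity to tend to zero.  Then the
  acceleration converges as well, and the same lemma applied to the velocity makes it tend to zero.
  The two limits say that the limit state is the static one.
\<close>

lemma limit_is_equilibrium:
  assumes d: "d \<ge> 1" and f: "cmc_solution d f J" and J: "{a..} \<subseteq> J"
    and lim: "(f \<longlongrightarrow> L) at_top" and L: "L > 0" and t0: "t0 \<in> J"
  shows "L = cmc_radius d" "cmc_energy d (f t0) (deriv f t0) = critical_energy d"
proof -
  define E where "E = cmc_energy d (f t0) (deriv f t0)"
  define g where "g t = lorentz_factor (deriv f t)" for t
  have inJ: "t \<in> J" if "t \<ge> a" for t using J that by auto
  note S = cmc_solutionD[OF f inJ]
  have "g t = f t + E / f t ^ d" if "t \<ge> a" for t
  proof -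
    have "E = f t ^ d * (g t - f t)"
      unfolding E_def g_def using cmc_energy_constant[OF f t0 inJ[OF that]] by (simp add: cmc_energy_def)
    then show ?thesis using S(1)[OF that] by simp
  qed
  then have g_eq: "eventually (\<lambda>t. f t + E / f t ^ d = g t) at_top"
    by (auto simp: eventually_at_top_linorder intro!: exI[of _ a])
  define G where "G = L + E / L ^ d"
  have "((\<lambda>t. f t + E / f t ^ d) \<longlongrightarrow> G) at_top"
    unfolding G_def using L by (intro tendsto_intros lim) auto
  then have g: "(g \<longlongrightarrow> G) at_top"
    using g_eq by (rule Lim_transform_eventually)
  have ev: "eventually (\<lambda>t. t \<ge> a) at_top" by (rule eventually_ge_at_top)
  have "eventually (\<lambda>t. 1 \<le> g t) at_top"
    using ev by eventually_elim (simp add: g_def lorentz_factor_ge_1 S(2))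
  with g have G1: "G \<ge> 1" by (rule tendsto_lowerbound) simp
  have v2_lim: "((\<lambda>t. (deriv f t)\<^sup>2) \<longlongrightarrow> 1 - 1 / G\<^sup>2) at_top"
  proof (rule Lim_transform_eventually)
    show "((\<lambda>t. 1 - 1 / (g t)\<^sup>2) \<longlongrightarrow> 1 - 1 / G\<^sup>2) at_top"
      using G1 by (intro tendsto_intros g) auto
    show "eventually (\<lambda>t. 1 - 1 / (g t)\<^sup>2 = (deriv f t)\<^sup>2) at_top"
      using ev by eventually_elim (simp add: g_def square_eq_lorentz_factor S(2))
  qed
  have G_eq: "1 - 1 / G\<^sup>2 = 0"
    using derivative_square_limit_zero[OF S(3) lim v2_lim] .
  then have "G\<^sup>2 = 1" by (simp add: field_simps split: if_splits)
  then have G: "G = 1" using G1 by (simp add: power2_eq_1_iff)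
  have v2: "((\<lambda>t. (deriv f t)\<^sup>2) \<longlongrightarrow> 0) at_top" using v2_lim G_eq by simp
  have v: "(deriv f \<longlongrightarrow> 0) at_top"
    using v2 tendsto_real_sqrt[OF v2] by (simp add: tendsto_rabs_zero_iff)
  have acc: "((\<lambda>t. (cmc_acceleration d (f t) (deriv f t))\<^sup>2) \<longlongrightarrow>
      ((1 - 0) * ((real d + 1) / 1 - real d / L))\<^sup>2) at_top"
  proof (rule Lim_transform_eventually)
    show "((\<lambda>t. ((1 - (deriv f t)\<^sup>2) * ((real d + 1) / g t - real d / f t))\<^sup>2) \<longlongrightarrow>
        ((1 - 0) * ((real d + 1) / 1 - real d / L))\<^sup>2) at_top"
      using L g by (intro tendsto_intros v2 lim) (auto simp: G)
    show "eventually (\<lambda>t. ((1 - (deriv f t)\<^sup>2) * ((real d + 1) / g t - real d / f t))\<^sup>2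
        = (cmc_acceleration d (f t) (deriv f t))\<^sup>2) at_top"
      using ev by eventually_elim (simp add: g_def cmc_acceleration_eq S(2))
  qed
  have "((1 - 0) * ((real d + 1) / 1 - real d / L))\<^sup>2 = 0"
    using derivative_square_limit_zero[OF S(4) v acc] .
  then show Lc: "L = cmc_radius d"
    using L by (simp add: cmc_radius_def field_simps)
  have "E = L ^ d * (1 - L)" using G L by (simp add: G_def field_simps)
  then show "cmc_energy d (f t0) (deriv f t0) = critical_energy d"
    by (simp add: E_def critical_energy_def Lc)
qed

lemma cmc_solution_between: "cmc_solution d f J \<Longrightarrow> a \<in> J \<Longrightarrow> b \<in> J \<Longrightarrow> a \<le> t \<Longrightarrow> t \<le> b \<Longrightarrow> t \<in> J"
  using cmc_solution_interval unfolding is_interval_1 by blast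

lemma cmc_solution_nondecreasing:
  assumes f: "cmc_solution d f J" and "a \<in> J" "b \<in> J" "a \<le> b"
    and "\<And>t. t \<in> J \<Longrightarrow> a \<le> t \<Longrightarrow> deriv f t \<ge> 0"
  shows "f a \<le> f b"
proof (rule DERIV_nonneg_imp_nondecreasing[OF \<open>a \<le> b\<close>])
  fix t assume "a \<le> t" "t \<le> b"
  then have "t \<in> J" by (rule cmc_solution_between[OF f \<open>a \<in> J\<close> \<open>b \<in> J\<close>])
  then show "\<exists>y. (f has_real_derivative y) (at t) \<and> y \<ge> 0"
    using cmc_solutionD(3)[OF f] assms(5) \<open>a \<le> t\<close> by blast
qed

lemma cmc_solution_nonincreasing:
  assumes f: "cmc_solution d f J" and "a \<in> J" "b \<in> J" "a \<le> b"
    and "\<And>t. t \<in> J \<Longrightarrow> a \<le> t \<Longrightarrow> deriv f t \<le> 0"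
  shows "f b \<le> f a"
proof (rule DERIV_nonpos_imp_nonincreasing[OF \<open>a \<le> b\<close>])
  fix t assume "a \<le> t" "t \<le> b"
  then have "t \<in> J" by (rule cmc_solution_between[OF f \<open>a \<in> J\<close> \<open>b \<in> J\<close>])
  then show "\<exists>y. (f has_real_derivative y) (at t) \<and> y \<le> 0"
    using cmc_solutionD(3)[OF f] assms(5) \<open>a \<le> t\<close> by blast
qed

lemma maximal_cmc_solutionD: "maximal_cmc_solution d f J \<Longrightarrow> cmc_solution d f J"
  unfolding maximal_cmc_solution_def by blast

text \<open>
  A rising solution stays away from radius zero and so exists forever; a bounded monotone function
  converges, and \<open>limit_is_equilibrium\<close> identifies the limit.
\<close>

lemma rising_cmc_solution:
  assumes d: "d \<ge> 1" and f: "maximal_cmc_solution d f J" and a: "a \<in> J"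
    and v: "\<And>t. t \<in> J \<Longrightarrow> a \<le> t \<Longrightarrow> deriv f t \<ge> 0"
  shows "{a..} \<subseteq> J"
    and "filterlim f at_top at_top \<or>
      ((f \<longlongrightarrow> cmc_radius d) at_top \<and> cmc_energy d (f a) (deriv f a) = critical_energy d)"
proof -
  note sol = maximal_cmc_solutionD[OF f]
  note fa = cmc_solutionD(1)[OF sol a]
  have ge: "f t \<ge> f a" if "t \<in> J" "a \<le> t" for t
    by (rule cmc_solution_nondecreasing[OF sol a that v])
  show J: "{a..} \<subseteq> J"
    by (rule maximal_cmc_solution_continues[OF f a fa ge])
  have mono: "f s \<le> f t" if "a \<le> s" "s \<le> t" for s t
    by (rule cmc_solution_nondecreasing[OF sol _ _ \<open>s \<le> t\<close>]) (use that v J in auto)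
  show "filterlim f at_top at_top \<or>
      ((f \<longlongrightarrow> cmc_radius d) at_top \<and> cmc_energy d (f a) (deriv f a) = critical_energy d)"
  proof (cases "bdd_above (f ` {a..})")
    case True
    define L where "L = Sup (f ` {a..})"
    have le: "f t \<le> L" if "a \<le> t" for t
      unfolding L_def using True that by (intro cSup_upper) auto
    have "(f \<longlongrightarrow> L) at_top"
    proof (rule increasing_tendsto)
      show "eventually (\<lambda>t. f t \<le> L) at_top"
        using eventually_ge_at_top[of a] by eventually_elim (rule le)
      fix x assume "x < L"
      then obtain s where "a \<le> s" "x < f s"
        unfolding L_def using less_cSup_iff[OF _ True] by auto
      then show "eventually (\<lambda>t. x < f t) at_top"
        by (intro eventually_at_top_linorderI[of s]) (use mono[of s] in force)
    qed
    moreover have "L > 0" using le[of a] fa by simp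
    ultimately have "L = cmc_radius d" "cmc_energy d (f a) (deriv f a) = critical_energy d"
      using limit_is_equilibrium[OF d sol J _ _ a] by blast+
    then show ?thesis using \<open>(f \<longlongrightarrow> L) at_top\<close> by blast
  next
    case False
    have "filterlim f at_top at_top"
      unfolding filterlim_at_top
    proof
      fix Z
      obtain s where "a \<le> s" "Z \<le> f s"
        using False bdd_aboveI[of "f ` {a..}" Z] by (metis atLeast_iff imageE nle_le)
      then show "eventually (\<lambda>t. Z \<le> f t) at_top"
        by (intro eventually_at_top_linorderI[of s]) (use mono[of s] in force)
    qed
    then show ?thesis by blast
  qed
qed

text \<open>
  If the radius stays away from zero, the solution exists forever and converges.  Otherwise it enters
  the region inside the critical radius, where the acceleration is negative: from then on it falls at
  least at a fixed speed, so its time of existence is finite, and at the end of that time the radius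
  tends to its infimum zero.
\<close>

lemma falling_cmc_solution:
  assumes d: "d \<ge> 1" and f: "maximal_cmc_solution d f J" and a: "a \<in> J"
    and v: "\<And>t. t \<in> J \<Longrightarrow> a \<le> t \<Longrightarrow> deriv f t \<le> 0"
  shows "collapses_in_finite_time a f J \<or>
      ({a..} \<subseteq> J \<and> (f \<longlongrightarrow> cmc_radius d) at_top \<and> cmc_energy d (f a) (deriv f a) = critical_energy d)"
proof (cases "\<exists>\<epsilon>>0. \<forall>t\<in>J. a \<le> t \<longrightarrow> \<epsilon> \<le> f t")
  case True
  note sol = maximal_cmc_solutionD[OF f]
  from True obtain \<epsilon> where \<epsilon>: "\<epsilon> > 0" "\<And>t. t \<in> J \<Longrightarrow> a \<le> t \<Longrightarrow> \<epsilon> \<le> f t" by blast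
  have J: "{a..} \<subseteq> J"
    by (rule maximal_cmc_solution_continues[OF f a \<epsilon>])
  have anti: "f t \<le> f s" if "a \<le> s" "s \<le> t" for s t
    by (rule cmc_solution_nonincreasing[OF sol _ _ \<open>s \<le> t\<close>]) (use that v J in auto)
  define L where "L = Inf (f ` {a..})"
  have bdd: "bdd_below (f ` {a..})" using \<epsilon>(2) J by (force simp: bdd_below_def)
  have ge: "L \<le> f t" if "a \<le> t" for t
    unfolding L_def using bdd that by (intro cInf_lower) auto
  have "(f \<longlongrightarrow> L) at_top"
  proof (rule decreasing_tendsto)
    show "eventually (\<lambda>t. L \<le> f t) at_top"
      using eventually_ge_at_top[of a] by eventually_elim (rule ge)
    fix x assume "L < x"
    then obtain s where "a \<le> s" "f s < x"
      unfolding L_def using cInf_less_iff[OF _ bdd] by auto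
    then show "eventually (\<lambda>t. f t < x) at_top"
      by (intro eventually_at_top_linorderI[of s]) (use anti[of s] in force)
  qed
  have "L \<ge> \<epsilon>" unfolding L_def using \<epsilon>(2) J by (intro cInf_greatest) auto
  then have "L > 0" using \<epsilon>(1) by simp
  then have "L = cmc_radius d" "cmc_energy d (f a) (deriv f a) = critical_energy d"
    using limit_is_equilibrium[OF d sol J \<open>(f \<longlongrightarrow> L) at_top\<close> _ a] by blast+
  then show ?thesis using J \<open>(f \<longlongrightarrow> L) at_top\<close> by blast
next
  case False
  note sol = maximal_cmc_solutionD[OF f]
  have small: "\<exists>t\<in>J. a \<le> t \<and> f t < \<epsilon>" if "\<epsilon> > 0" for \<epsilon>
    using False that by force
  have anti: "f t \<le> f s" if "s \<in> J" "t \<in> J" "a \<le> s" "s \<le> t" for s t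
    by (rule cmc_solution_nonincreasing[OF sol that(1,2,4) v[OF _ order_trans[OF that(3)]]])
  obtain b where b: "b \<in> J" "a \<le> b" "f b < cmc_radius d"
    using small[OF cmc_radius_bounds(1)[OF d]] by blast
  have acc: "cmc_acceleration d (f t) (deriv f t) < 0" if "t \<in> J" "b \<le> t" for t
    using cmc_acceleration_neg_inside[OF cmc_solutionD(1)[OF sol that(1)] _ cmc_solutionD(2)[OF sol that(1)]]
      anti[of b t] b that by simp
  obtain e where e: "e > 0" "cball b e \<subseteq> J"
    using cmc_solution_open[OF sol] b(1) open_contains_cball by blast
  define c where "c = b + e"
  have c: "c \<in> J" "b < c" using e by (auto simp: c_def dist_real_def)
  have decr: "deriv f t < deriv f s" if "s \<in> J" "t \<in> J" "b \<le> s" "s < t" for s t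
  proof (rule DERIV_neg_imp_decreasing[OF \<open>s < t\<close>])
    fix x assume "s \<le> x" "x \<le> t"
    then have "x \<in> J" "b \<le> x" using cmc_solution_between[OF sol that(1,2)] that by auto
    then show "\<exists>y. (deriv f has_real_derivative y) (at x) \<and> y < 0"
      using cmc_solutionD(4)[OF sol] acc by blast
  qed
  \<comment> \<open>The time \<open>c\<close> lies strictly after \<open>b\<close>, so that the velocity \<open>m\<close> is negative even
    if it vanishes at \<open>b\<close>.\<close>
  define m where "m = deriv f c"
  have "deriv f b \<le> 0" using v b by blast
  then have m: "m < 0" using decr[OF b(1) c(1)] c by (simp add: m_def)
  have bound: "t \<le> c + f c / (- m)" if t: "t \<in> J" for t
  proof (cases "c < t")
    case True
    have "f t - m * t \<le> f c - m * c"
    proof (rule DERIV_nonpos_imp_nonincreasing[of c t "\<lambda>t. f t - m * t"])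
      fix x assume x: "c \<le> x" "x \<le> t"
      then have xJ: "x \<in> J" using cmc_solution_between[OF sol c(1) t] by blast
      then have "deriv f x \<le> m"
        using decr[OF c(1), of x] c x by (cases "x = c") (auto simp: m_def)
      moreover have "((\<lambda>t. f t - m * t) has_real_derivative deriv f x - m) (at x)"
        using cmc_solutionD(3)[OF sol xJ] by (auto intro!: derivative_eq_intros)
      ultimately show "\<exists>y. ((\<lambda>t. f t - m * t) has_real_derivative y) (at x) \<and> y \<le> 0" by force
    qed (use True in auto)
    then have "(t - c) * (- m) < f c"
      using cmc_solutionD(1)[OF sol t] by (simp add: algebra_simps)
    then have "t - c < f c / (- m)" using m by (simp only: pos_less_divide_eq neg_0_less_iff_less)
    then show ?thesis by simp
  next
    case False
    have "f c / (- m) > 0" using m cmc_solutionD(1)[OF sol c(1)] by (intro divide_pos_pos) auto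
    then show ?thesis using False by simp
  qed
  then have bdd: "bdd_above J" by (rule bdd_aboveI)
  define T where "T = Sup J"
  have upper: "t < T" if "t \<in> J" for t
    unfolding T_def by (rule less_Sup_of_open[OF cmc_solution_open[OF sol] bdd that])
  have sub: "{a..<T} \<subseteq> J"
  proof
    fix t assume "t \<in> {a..<T}"
    then obtain s where "s \<in> J" "t < s"
      unfolding T_def using less_cSup_iff[OF _ bdd] a by auto
    then show "t \<in> J" using cmc_solution_between[OF sol a, of s t] \<open>t \<in> {a..<T}\<close> by simp
  qed
  have "(f \<longlongrightarrow> 0) (at_left T)"
  proof (rule decreasing_tendsto)
    have "eventually (\<lambda>t. t \<in> {a<..<T}) (at_left T)"
      using upper[OF a] by (intro eventually_at_left_real)
    then show "eventually (\<lambda>t. 0 \<le> f t) (at_left T)"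
    proof eventually_elim
      fix t assume "t \<in> {a<..<T}"
      then have "t \<in> J" using sub by auto
      then show "0 \<le> f t" using cmc_solutionD(1)[OF sol] by (simp add: less_imp_le)
    qed
    fix x :: real assume "0 < x"
    then obtain s where s: "s \<in> J" "a \<le> s" "f s < x" using small by blast
    have "eventually (\<lambda>t. t \<in> {s<..<T}) (at_left T)"
      using upper[OF s(1)] by (intro eventually_at_left_real)
    then show "eventually (\<lambda>t. f t < x) (at_left T)"
    proof eventually_elim
      fix t assume "t \<in> {s<..<T}"
      then have "t \<in> J" "s \<le> t" using sub s(2) by auto
      then show "f t < x" using anti[OF s(1) _ s(2)] s(3) by force
    qed
  qed
  then show ?thesis
    using upper[OF a] sub unfolding collapses_in_finite_time_def by blast
qed

section \<open>Crossing the barrier, or being reflected by it\<close>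

lemma positive_on_interval:
  fixes g :: "real \<Rightarrow> real"
  assumes "is_interval J" "\<And>t. t \<in> J \<Longrightarrow> isCont g t" "\<And>t. t \<in> J \<Longrightarrow> g t \<noteq> 0"
    and "a \<in> J" "g a > 0" "t \<in> J"
  shows "g t > 0"
proof (rule ccontr)
  assume "\<not> g t > 0"
  have "continuous_on J g"
    using assms(2) by (simp add: continuous_at_imp_continuous_on)
  then have "connected (g ` J)"
    using assms(1) by (intro connected_continuous_image) (simp_all add: is_interval_connected_1)
  moreover have "g t \<in> g ` J" "g a \<in> g ` J" using \<open>t \<in> J\<close> \<open>a \<in> J\<close> by simp_all
  moreover have "g t \<le> 0" "0 \<le> g a" using \<open>\<not> g t > 0\<close> \<open>g a > 0\<close> by simp_all
  ultimately have "0 \<in> g ` J" by (rule connectedD_interval)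
  then show False using assms(3) by force
qed

lemma collapses_in_finite_time_earlier:
  assumes "cmc_solution d f J" "t0 \<in> J" "a \<in> J" "t0 \<le> a" "collapses_in_finite_time a f J"
  shows "collapses_in_finite_time t0 f J"
proof -
  from assms(5) obtain T where T: "T > a" "{a..<T} \<subseteq> J" "(f \<longlongrightarrow> 0) (at_left T)"
    unfolding collapses_in_finite_time_def by blast
  have "{t0..<T} \<subseteq> J"
  proof
    fix t assume "t \<in> {t0..<T}"
    then show "t \<in> J"
      using cmc_solution_between[OF assms(1-3), of t] T(2) by (cases "t \<le> a") auto
  qed
  then show ?thesis
    using T assms(4) unfolding collapses_in_finite_time_def by (intro exI[of _ T]) auto
qed

lemma equilibrium_solution_constant:
  assumes d: "d \<ge> 1" and f: "cmc_solution d f J" and s: "s \<in> J"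
    and eq: "f s = cmc_radius d" "deriv f s = 0" and t: "t \<in> J"
  shows "f t = cmc_radius d" "deriv f t = 0"
proof -
  have "deriv f s = deriv (\<lambda>_. cmc_radius d) s" using eq(2) by simp
  note * = cmc_unique[OF f cmc_solution_constant[OF d] s UNIV_I eq(1) this t UNIV_I]
  show "f t = cmc_radius d" by (rule *(1))
  show "deriv f t = 0" using *(2) by simp
qed

text \<open>
  Above the critical energy the Lorentz factor exceeds \<open>critical_lorentz_factor d (f t) \<ge> 1\<close>, so the
  velocity keeps its sign.  The solution is monotone and cannot converge since its energy is not
  the critical one.
\<close>

lemma supercritical_cmc_solution:
  assumes d: "d \<ge> 1" and f: "maximal_cmc_solution d f J" and t0: "t0 \<in> J"
    and E: "cmc_energy d (f t0) (deriv f t0) > critical_energy d"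
  shows "deriv f t0 > 0 \<Longrightarrow> expands_indefinitely t0 f J"
    and "deriv f t0 < 0 \<Longrightarrow> collapses_in_finite_time t0 f J"
proof -
  note sol = maximal_cmc_solutionD[OF f]
  note int = cmc_solution_interval[OF sol]
  have cont: "isCont (deriv f) t" if "t \<in> J" for t
    using cmc_solutionD(4)[OF sol that] by (rule DERIV_isCont)
  have nz: "deriv f t \<noteq> 0" if "t \<in> J" for t
  proof -
    have "lorentz_factor (deriv f t) > critical_lorentz_factor d (f t)"
      using E cmc_energy_constant[OF sol t0 that] cmc_energy_critical_iff(3)[OF cmc_solutionD(1)[OF sol that]]
      by simp
    then show ?thesis
      using critical_lorentz_factor_ge_1[OF d cmc_solutionD(1)[OF sol that]] by auto
  qed
  show "expands_indefinitely t0 f J" if "deriv f t0 > 0"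
  proof -
    have "deriv f t > 0" if "t \<in> J" for t
      by (rule positive_on_interval[OF int cont nz t0 \<open>deriv f t0 > 0\<close> that])
    then have v: "deriv f t \<ge> 0" if "t \<in> J" "t0 \<le> t" for t
      using that by (simp add: less_imp_le)
    show ?thesis
      using rising_cmc_solution[OF d f t0 v] E unfolding expands_indefinitely_def by auto
  qed
  show "collapses_in_finite_time t0 f J" if "deriv f t0 < 0"
  proof -
    have "- deriv f t > 0" if "t \<in> J" for t
      by (rule positive_on_interval[OF int _ _ t0 _ that]) (use cont nz \<open>deriv f t0 < 0\<close> in auto)
    then have v: "deriv f t \<le> 0" if "t \<in> J" "t0 \<le> t" for t
      using that by (simp add: less_imp_le)
    show ?thesis
      using falling_cmc_solution[OF d f t0 v] E by auto
  qed
qed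

text \<open>
  At the radius of the static solution, an energy not above the critical one permits only the Lorentz factor \<open>1\<close>.
  A solution that reaches this radius therefore has velocity zero there and, by uniqueness, is
  the static solution.
\<close>

lemma subcritical_radius_avoided:
  assumes d: "d \<ge> 1" and f: "cmc_solution d f J" and t0: "t0 \<in> J"
    and E: "cmc_energy d (f t0) (deriv f t0) \<le> critical_energy d"
    and "f t0 \<noteq> cmc_radius d" and t: "t \<in> J"
  shows "f t \<noteq> cmc_radius d"
proof
  assume eq: "f t = cmc_radius d"
  note S = cmc_solutionD[OF f t]
  have "lorentz_factor (deriv f t) \<le> critical_lorentz_factor d (f t)"
    using E cmc_energy_constant[OF f t0 t] cmc_energy_critical_iff(3)[OF S(1), of d "deriv f t"] by simp
  then have "deriv f t = 0"
    using lorentz_factor_ge_1[OF S(2)] lorentz_factor_eq_1_iff[OF S(2)]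
    by (simp add: eq critical_lorentz_factor_at_radius[OF d])
  then have "f t0 = cmc_radius d"
    by (rule equilibrium_solution_constant[OF d f t eq _ t0])
  then show False using assms(5) by simp
qed

text \<open>
  Away from the static radius the critical Lorentz factor is greater than \<open>1\<close>.
\<close>

lemma critical_velocity_nonzero:
  assumes d: "d \<ge> 1" and f: "cmc_solution d f J" and t0: "t0 \<in> J"
    and E: "cmc_energy d (f t0) (deriv f t0) = critical_energy d"
    and "f t0 \<noteq> cmc_radius d" and t: "t \<in> J"
  shows "deriv f t \<noteq> 0"
proof -
  note S = cmc_solutionD[OF f t]
  have "f t \<noteq> cmc_radius d"
    by (rule subcritical_radius_avoided[OF d f t0 _ assms(5) t]) (simp add: E)
  then have "critical_lorentz_factor d (f t) > 1"
    by (rule critical_lorentz_factor_gt_1[OF d S(1)])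
  moreover have "lorentz_factor (deriv f t) = critical_lorentz_factor d (f t)"
    using E cmc_energy_constant[OF f t0 t] cmc_energy_critical_iff(2)[OF S(1), of d "deriv f t"] by simp
  ultimately show ?thesis by auto
qed

text \<open>
  The solution stays outside the critical radius, where its acceleration is positive.  Once its
  velocity is nonnegative it rises forever, and it cannot converge to the critical radius, which lies
  below it.  If the velocity is always negative, the solution falls without reaching the critical
  radius, so it converges, which happens at the critical energy only.  At that energy the velocity
  never changes sign.
\<close>

lemma subcritical_cmc_solution_outside:
  assumes d: "d \<ge> 1" and f: "maximal_cmc_solution d f J" and t0: "t0 \<in> J"
    and E: "cmc_energy d (f t0) (deriv f t0) \<le> critical_energy d"
    and out: "f t0 > cmc_radius d"
  shows "cmc_energy d (f t0) (deriv f t0) < critical_energy d \<or> deriv f t0 \<ge> 0 \<Longrightarrow> expands_indefinitely t0 f J"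
    and "cmc_energy d (f t0) (deriv f t0) = critical_energy d \<Longrightarrow> deriv f t0 < 0 \<Longrightarrow>
      converges_to_future t0 (cmc_radius d) f J"
proof -
  note sol = maximal_cmc_solutionD[OF f]
  have contf: "isCont f t" if "t \<in> J" for t
    using cmc_solutionD(3)[OF sol that] by (rule DERIV_isCont)
  have gt: "f t > cmc_radius d" if "t \<in> J" for t
    using positive_on_interval[OF cmc_solution_interval[OF sol], of "\<lambda>t. f t - cmc_radius d" t0 t]
      subcritical_radius_avoided[OF d sol t0 E] contf t0 out that by auto
  have acc: "cmc_acceleration d (f t) (deriv f t) > 0" if "t \<in> J" for t
    using cmc_acceleration_pos_outside[OF d gt[OF that] cmc_solutionD(2)[OF sol that]]
      E cmc_energy_constant[OF sol t0 that] by simp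
  have incr: "deriv f s < deriv f t" if "s \<in> J" "t \<in> J" "s < t" for s t
  proof (rule DERIV_pos_imp_increasing[OF \<open>s < t\<close>])
    fix x assume "s \<le> x" "x \<le> t"
    then have "x \<in> J" by (rule cmc_solution_between[OF sol that(1,2)])
    then show "\<exists>y. (deriv f has_real_derivative y) (at x) \<and> y > 0"
      using cmc_solutionD(4)[OF sol] acc by blast
  qed
  have expands: "expands_indefinitely t0 f J" if a: "a \<in> J" "t0 \<le> a" "deriv f a \<ge> 0" for a
  proof -
    have v: "deriv f t \<ge> 0" if "t \<in> J" "a \<le> t" for t
      using incr[OF a(1) that(1)] a(3) that(2) by (cases "a = t") auto
    note R = rising_cmc_solution[OF d f a(1) v]
    have "\<not> (f \<longlongrightarrow> cmc_radius d) at_top"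
    proof
      assume lim: "(f \<longlongrightarrow> cmc_radius d) at_top"
      have "f a \<le> f t" if "a \<le> t" for t
        by (rule cmc_solution_nondecreasing[OF sol a(1) _ that v]) (use that R(1) in auto)
      then have "eventually (\<lambda>t. f a \<le> f t) at_top"
        by (rule eventually_at_top_linorderI)
      with lim have "f a \<le> cmc_radius d" by (rule tendsto_lowerbound) simp
      then show False using gt[OF a(1)] by simp
    qed
    then have "filterlim f at_top at_top" using R(2) by blast
    moreover have "{t0..} \<subseteq> J"
    proof
      fix t assume "t \<in> {t0..}"
      then show "t \<in> J" using R(1) cmc_solution_between[OF sol t0 a(1), of t] by (cases "a \<le> t") auto
    qed
    ultimately show ?thesis unfolding expands_indefinitely_def by blast
  qed
  have converges: "cmc_energy d (f t0) (deriv f t0) = critical_energy d \<and> converges_to_future t0 (cmc_radius d) f J"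
    if neg: "\<And>t. t \<in> J \<Longrightarrow> t0 \<le> t \<Longrightarrow> deriv f t < 0"
  proof -
    have v: "deriv f t \<le> 0" if "t \<in> J" "t0 \<le> t" for t using neg[OF that] by simp
    have "\<not> collapses_in_finite_time t0 f J"
    proof
      assume "collapses_in_finite_time t0 f J"
      then obtain T where T: "T > t0" "{t0..<T} \<subseteq> J" "(f \<longlongrightarrow> 0) (at_left T)"
        unfolding collapses_in_finite_time_def by blast
      have "eventually (\<lambda>t. t \<in> {t0<..<T}) (at_left T)"
        using T(1) by (rule eventually_at_left_real)
      then have "eventually (\<lambda>t. cmc_radius d \<le> f t) (at_left T)"
      proof eventually_elim
        fix t assume "t \<in> {t0<..<T}"
        then have "t \<in> J" using T(2) by auto
        then show "cmc_radius d \<le> f t" using gt by (simp add: less_imp_le)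
      qed
      with T(3) have "cmc_radius d \<le> 0" by (rule tendsto_lowerbound) simp
      then show False using cmc_radius_bounds(1)[OF d] by simp
    qed
    then show ?thesis
      using falling_cmc_solution[OF d f t0 v] unfolding converges_to_future_def by blast
  qed
  show "expands_indefinitely t0 f J"
    if "cmc_energy d (f t0) (deriv f t0) < critical_energy d \<or> deriv f t0 \<ge> 0"
  proof (rule ccontr)
    assume "\<not> expands_indefinitely t0 f J"
    then have neg: "deriv f t < 0" if "t \<in> J" "t0 \<le> t" for t
      using expands[OF that] by (rule contrapos_np) simp
    show False using converges[OF neg] neg[OF t0] that by simp
  qed
  show "converges_to_future t0 (cmc_radius d) f J"
    if eq: "cmc_energy d (f t0) (deriv f t0) = critical_energy d" and "deriv f t0 < 0"
  proof -
    have nz: "deriv f t \<noteq> 0" if "t \<in> J" for t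
      using critical_velocity_nonzero[OF d sol t0 eq _ that] out by simp
    have "- deriv f t > 0" if "t \<in> J" for t
    proof (rule positive_on_interval[OF cmc_solution_interval[OF sol] _ _ t0 _ that])
      show "isCont (\<lambda>t. - deriv f t) s" if "s \<in> J" for s
        using DERIV_isCont[OF cmc_solutionD(4)[OF sol that]] by (rule isCont_minus)
    qed (use nz \<open>deriv f t0 < 0\<close> in auto)
    then show ?thesis using converges by simp
  qed
qed

text \<open>
  The mirror image of \<open>subcritical_cmc_solution_outside\<close>: the acceleration is negative, and rising
  forever while remaining inside the critical radius leaves convergence as the only possibility.
\<close>

lemma subcritical_cmc_solution_inside:
  assumes d: "d \<ge> 1" and f: "maximal_cmc_solution d f J" and t0: "t0 \<in> J"
    and E: "cmc_energy d (f t0) (deriv f t0) \<le> critical_energy d"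
    and ins: "f t0 < cmc_radius d"
  shows "cmc_energy d (f t0) (deriv f t0) < critical_energy d \<or> deriv f t0 \<le> 0 \<Longrightarrow> collapses_in_finite_time t0 f J"
    and "cmc_energy d (f t0) (deriv f t0) = critical_energy d \<Longrightarrow> deriv f t0 > 0 \<Longrightarrow>
      converges_to_future t0 (cmc_radius d) f J"
proof -
  note sol = maximal_cmc_solutionD[OF f]
  have contf: "isCont f t" if "t \<in> J" for t
    using cmc_solutionD(3)[OF sol that] by (rule DERIV_isCont)
  have lt: "f t < cmc_radius d" if "t \<in> J" for t
    using positive_on_interval[OF cmc_solution_interval[OF sol], of "\<lambda>t. cmc_radius d - f t" t0 t]
      subcritical_radius_avoided[OF d sol t0 E] contf t0 ins that by force
  have acc: "cmc_acceleration d (f t) (deriv f t) < 0" if "t \<in> J" for t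
    using cmc_acceleration_neg_inside[OF cmc_solutionD(1)[OF sol that] lt[OF that] cmc_solutionD(2)[OF sol that]] .
  have decr: "deriv f t < deriv f s" if "s \<in> J" "t \<in> J" "s < t" for s t
  proof (rule DERIV_neg_imp_decreasing[OF \<open>s < t\<close>])
    fix x assume "s \<le> x" "x \<le> t"
    then have "x \<in> J" by (rule cmc_solution_between[OF sol that(1,2)])
    then show "\<exists>y. (deriv f has_real_derivative y) (at x) \<and> y < 0"
      using cmc_solutionD(4)[OF sol] acc by blast
  qed
  have collapses: "collapses_in_finite_time t0 f J" if a: "a \<in> J" "t0 \<le> a" "deriv f a \<le> 0" for a
  proof -
    have v: "deriv f t \<le> 0" if "t \<in> J" "a \<le> t" for t
      using decr[OF a(1) that(1)] a(3) that(2) by (cases "a = t") auto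
    have "\<not> ({a..} \<subseteq> J \<and> (f \<longlongrightarrow> cmc_radius d) at_top)"
    proof
      assume lim: "{a..} \<subseteq> J \<and> (f \<longlongrightarrow> cmc_radius d) at_top"
      have "f t \<le> f a" if "a \<le> t" for t
        by (rule cmc_solution_nonincreasing[OF sol a(1) _ that v]) (use that lim in auto)
      then have "eventually (\<lambda>t. f t \<le> f a) at_top"
        by (rule eventually_at_top_linorderI)
      with lim[THEN conjunct2] have "cmc_radius d \<le> f a" by (rule tendsto_upperbound) simp
      then show False using lt[OF a(1)] by simp
    qed
    then have "collapses_in_finite_time a f J"
      using falling_cmc_solution[OF d f a(1) v] by blast
    then show ?thesis using collapses_in_finite_time_earlier[OF sol t0 a(1,2)] by blast
  qed
  have converges: "cmc_energy d (f t0) (deriv f t0) = critical_energy d \<and> converges_to_future t0 (cmc_radius d) f J"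
    if pos: "\<And>t. t \<in> J \<Longrightarrow> t0 \<le> t \<Longrightarrow> deriv f t > 0"
  proof -
    have v: "deriv f t \<ge> 0" if "t \<in> J" "t0 \<le> t" for t using pos[OF that] by simp
    note R = rising_cmc_solution[OF d f t0 v]
    have "\<not> filterlim f at_top at_top"
    proof
      assume "filterlim f at_top at_top"
      then have "eventually (\<lambda>t. cmc_radius d \<le> f t) at_top" by (simp add: filterlim_at_top)
      then have "eventually (\<lambda>t. cmc_radius d \<le> f t \<and> t \<ge> t0) at_top"
        using eventually_ge_at_top by (rule eventually_conj)
      then obtain t where "cmc_radius d \<le> f t" "t \<ge> t0"
        using eventually_happens trivial_limit_at_top_linorder by blast
      then show False using lt[of t] R(1) by force
    qed
    then show ?thesis
      using R unfolding converges_to_future_def by blast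
  qed
  show "collapses_in_finite_time t0 f J"
    if "cmc_energy d (f t0) (deriv f t0) < critical_energy d \<or> deriv f t0 \<le> 0"
  proof (rule ccontr)
    assume "\<not> collapses_in_finite_time t0 f J"
    then have pos: "deriv f t > 0" if "t \<in> J" "t0 \<le> t" for t
      using collapses[OF that] by (rule contrapos_np) simp
    show False using converges[OF pos] pos[OF t0] that by simp
  qed
  show "converges_to_future t0 (cmc_radius d) f J"
    if eq: "cmc_energy d (f t0) (deriv f t0) = critical_energy d" and "deriv f t0 > 0"
  proof -
    have nz: "deriv f t \<noteq> 0" if "t \<in> J" for t
      using critical_velocity_nonzero[OF d sol t0 eq _ that] ins by simp
    have "deriv f t > 0" if "t \<in> J" for t
      by (rule positive_on_interval[OF cmc_solution_interval[OF sol] DERIV_isCont[OF cmc_solutionD(4)[OF sol]]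
            nz t0 \<open>deriv f t0 > 0\<close> that])
    then show ?thesis using converges by simp
  qed
qed

section \<open>Comparison of velocity and radius\<close>

text \<open>
  The signs make monotone functions of velocity and radius out of \<open>\<gamma> - 1\<close> and \<open>h - 1\<close>, which both have
  a minimum at the static solution.  Their absolute values compare the energy with the critical one
  (\<open>cmc_energy_critical_iff\<close>), their signs tell the direction of motion and the side of the critical
  radius.
\<close>

definition signed_lorentz_excess :: "real \<Rightarrow> real" where
  "signed_lorentz_excess v = sgn v * (lorentz_factor v - 1)"

definition critical_excess :: "nat \<Rightarrow> real \<Rightarrow> real" where
  "critical_excess d x = sgn (cmc_radius d - x) * (critical_lorentz_factor d x - 1)"

lemma abs_signed_lorentz_excess:
  assumes "\<bar>v\<bar> < 1"
  shows "\<bar>signed_lorentz_excess v\<bar> = lorentz_factor v - 1"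
  using lorentz_factor_ge_1[OF assms] by (cases "v = 0") (auto simp: signed_lorentz_excess_def abs_mult abs_sgn_eq)

lemma abs_critical_excess:
  assumes "d \<ge> 1" "x > 0"
  shows "\<bar>critical_excess d x\<bar> = critical_lorentz_factor d x - 1"
  using critical_lorentz_factor_ge_1[OF assms] critical_lorentz_factor_at_radius[OF assms(1)]
  by (cases "x = cmc_radius d") (auto simp: critical_excess_def abs_mult abs_sgn_eq)

lemma sgn_signed_lorentz_excess:
  assumes "\<bar>v\<bar> < 1"
  shows "sgn (signed_lorentz_excess v) = sgn v"
  using lorentz_factor_ge_1[OF assms] lorentz_factor_eq_1_iff[OF assms]
  by (cases "v = 0") (auto simp: signed_lorentz_excess_def sgn_mult)

lemma sgn_critical_excess:
  assumes "d \<ge> 1" "x > 0"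
  shows "sgn (critical_excess d x) = sgn (cmc_radius d - x)"
  using critical_lorentz_factor_gt_1[OF assms]
  by (cases "x = cmc_radius d") (auto simp: critical_excess_def sgn_mult)

text \<open>
  Suppose \<open>S l > C r\<close>, where \<open>S\<close> and \<open>C\<close> denote the two signed excesses.  If the energy is above the
  critical one, \<open>\<bar>S l\<bar> > \<bar>C r\<bar>\<close> and hence \<open>S l > 0\<close>: the solution moves outwards.  If it is not,
  \<open>\<bar>S l\<bar> \<le> \<bar>C r\<bar>\<close> and hence \<open>C r < 0\<close>: the solution starts outside the critical radius.  The case
  \<open>S l < C r\<close> is symmetric, and equality means critical energy with a motion towards the critical
  radius, or the static solution.
\<close>

theorem cmc_trichotomy:
  assumes d: "d \<ge> 1" and max: "maximal_cmc_solution_with_data d t0 r l f J"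
  shows "signed_lorentz_excess l > critical_excess d r \<Longrightarrow> expands_indefinitely t0 f J"
    and "signed_lorentz_excess l < critical_excess d r \<Longrightarrow> collapses_in_finite_time t0 f J"
    and "signed_lorentz_excess l = critical_excess d r \<Longrightarrow> converges_to_future t0 (cmc_radius d) f J"
proof -
  from max have f: "maximal_cmc_solution d f J" and t0: "t0 \<in> J" and [simp]: "f t0 = r" "deriv f t0 = l"
    unfolding maximal_cmc_solution_with_data_def by blast+
  note sol = maximal_cmc_solutionD[OF f]
  have r: "r > 0" and l: "\<bar>l\<bar> < 1" using cmc_solutionD(1,2)[OF sol t0] by simp_all
  let ?E = "cmc_energy d r l" and ?Ecrit = "critical_energy d"
  let ?G = "signed_lorentz_excess l" and ?C = "critical_excess d r"
  have E: "?E < ?Ecrit \<longleftrightarrow> \<bar>?G\<bar> < \<bar>?C\<bar>" "?E = ?Ecrit \<longleftrightarrow> \<bar>?G\<bar> = \<bar>?C\<bar>" "?E > ?Ecrit \<longleftrightarrow> \<bar>?G\<bar> > \<bar>?C\<bar>"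
    unfolding cmc_energy_critical_iff[OF r] abs_signed_lorentz_excess[OF l] abs_critical_excess[OF d r]
    by linarith+
  have "sgn ?G > 0 \<longleftrightarrow> sgn l > 0" "sgn ?G < 0 \<longleftrightarrow> sgn l < 0"
    unfolding sgn_signed_lorentz_excess[OF l] by (rule refl)+
  then have sl: "l > 0 \<longleftrightarrow> ?G > 0" "l < 0 \<longleftrightarrow> ?G < 0" by simp_all
  have "sgn ?C > 0 \<longleftrightarrow> sgn (cmc_radius d - r) > 0" "sgn ?C < 0 \<longleftrightarrow> sgn (cmc_radius d - r) < 0"
    unfolding sgn_critical_excess[OF d r] by (rule refl)+
  then have sr: "r < cmc_radius d \<longleftrightarrow> ?C > 0" "r > cmc_radius d \<longleftrightarrow> ?C < 0" by simp_all
  note super = supercritical_cmc_solution[OF d f t0, simplified]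
  note out = subcritical_cmc_solution_outside[OF d f t0, simplified]
  note ins = subcritical_cmc_solution_inside[OF d f t0, simplified]
  show "expands_indefinitely t0 f J" if "?G > ?C"
  proof (cases "?E > ?Ecrit")
    case True
    then have "l > 0" using that E sl by linarith
    then show ?thesis by (rule super(1)[OF True])
  next
    case False
    then have le: "?E \<le> ?Ecrit" and "\<bar>?G\<bar> \<le> \<bar>?C\<bar>" using E by linarith+
    then have "r > cmc_radius d" using that sr by linarith
    moreover have "?E < ?Ecrit \<or> l \<ge> 0" using that le E sl by linarith
    ultimately show ?thesis using out(1)[OF le] by blast
  qed
  show "collapses_in_finite_time t0 f J" if "?G < ?C"
  proof (cases "?E > ?Ecrit")
    case True
    then have "l < 0" using that E sl by linarith
    then show ?thesis by (rule super(2)[OF True])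
  next
    case False
    then have le: "?E \<le> ?Ecrit" and "\<bar>?G\<bar> \<le> \<bar>?C\<bar>" using E by linarith+
    then have "r < cmc_radius d" using that sr by linarith
    moreover have "?E < ?Ecrit \<or> l \<le> 0" using that le E sl by linarith
    ultimately show ?thesis using ins(1)[OF le] by blast
  qed
  show "converges_to_future t0 (cmc_radius d) f J" if eq: "?G = ?C"
  proof (cases "r = cmc_radius d")
    case False
    have "?E = ?Ecrit" using E eq by simp
    show ?thesis
    proof (cases "r < cmc_radius d")
      case True
      then have "l > 0" using sl sr eq by simp
      then show ?thesis using ins(2)[OF True] \<open>?E = ?Ecrit\<close> by simp
    next
      case False
      then have *: "r > cmc_radius d" using \<open>r \<noteq> cmc_radius d\<close> by simp
      then have "l < 0" using sl sr eq by simp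
      then show ?thesis using out(2)[OF *] \<open>?E = ?Ecrit\<close> by simp
    qed
  next
    case True
    then have "?C = 0" using sr by linarith
    then have "l = 0" using sl eq by linarith
    have c: "f t = cmc_radius d" if "t \<in> J" for t
      using equilibrium_solution_constant(1)[OF d sol t0 _ _ that] True \<open>l = 0\<close> by simp
    have sub: "{t0..} \<subseteq> J"
      by (rule maximal_cmc_solution_continues[OF f t0 cmc_radius_bounds(1)[OF d]]) (simp add: c)
    have "eventually (\<lambda>t. cmc_radius d = f t) at_top"
      by (rule eventually_at_top_linorderI[of t0]) (use sub c in auto)
    then have "(f \<longlongrightarrow> cmc_radius d) at_top"
      by (rule Lim_transform_eventually[OF tendsto_const])
    then show ?thesis using sub by (simp add: converges_to_future_def)
  qed
qed

lemma signed_lorentz_excess_strict_mono: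
  assumes "u < v" "\<bar>u\<bar> < 1" "\<bar>v\<bar> < 1"
  shows "signed_lorentz_excess u < signed_lorentz_excess v"
proof -
  consider "0 \<le> u" | "v \<le> 0" | "u < 0" "0 < v" using assms(1) by linarith
  then show ?thesis
  proof cases
    case 1
    then have "lorentz_factor u < lorentz_factor v"
      using assms by (intro lorentz_factor_less) auto
    then show ?thesis using 1 assms(1) lorentz_factor_ge_1[OF assms(2)]
      by (cases "u = 0") (auto simp: signed_lorentz_excess_def)
  next
    case 2
    then have "lorentz_factor v < lorentz_factor u"
      using assms by (intro lorentz_factor_less) auto
    then show ?thesis using 2 assms(1) lorentz_factor_ge_1[OF assms(3)]
      by (cases "v = 0") (auto simp: signed_lorentz_excess_def)
  next
    case 3
    then have "lorentz_factor u > 1" "lorentz_factor v > 1"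
      using lorentz_factor_less[of 0 u] lorentz_factor_less[of 0 v] assms by auto
    then show ?thesis using 3 by (simp add: signed_lorentz_excess_def)
  qed
qed

lemma signed_lorentz_excess_surj: "\<exists>v. \<bar>v\<bar> < 1 \<and> signed_lorentz_excess v = y"
proof (cases "y = 0")
  case True
  then show ?thesis by (intro exI[of _ 0]) (simp add: signed_lorentz_excess_def)
next
  case False
  define g where "g = 1 + \<bar>y\<bar>"
  define w where "w = sqrt (1 - 1 / g\<^sup>2)"
  have g: "g > 1" using False by (simp add: g_def)
  then have q: "1 / g\<^sup>2 < 1" "1 / g\<^sup>2 > 0" by (simp_all add: one_less_power)
  then have w: "w > 0" "w\<^sup>2 = 1 - 1 / g\<^sup>2" by (simp_all add: w_def)
  have v2: "(sgn y * w)\<^sup>2 = 1 - 1 / g\<^sup>2"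
    using False w by (simp add: power_mult_distrib sgn_real_def)
  have "\<bar>sgn y * w\<bar> < 1"
    using v2 q by (simp flip: abs_square_less_1)
  moreover have "lorentz_factor (sgn y * w) = g"
    using g by (simp add: lorentz_factor_def v2 real_sqrt_divide)
  then have "signed_lorentz_excess (sgn y * w) = y"
    using w False by (simp add: signed_lorentz_excess_def sgn_mult g_def mult_sgn_abs)
  ultimately show ?thesis by blast
qed

lemma critical_excess_strict_antimono:
  assumes d: "d \<ge> 1" and "0 < x" "x < y"
  shows "critical_excess d y < critical_excess d x"
proof -
  let ?c = "cmc_radius d"
  consider "y \<le> ?c" | "?c \<le> x" | "x < ?c" "?c < y" by linarith
  then show ?thesis
  proof cases
    case 1
    then show ?thesis
      using critical_lorentz_factor_less(1)[OF d assms(2,3) 1] assms critical_lorentz_factor_at_radius[OF d]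
      by (cases "y = ?c") (auto simp: critical_excess_def)
  next
    case 2
    then show ?thesis
      using critical_lorentz_factor_less(2)[OF d 2 assms(3)] assms critical_lorentz_factor_at_radius[OF d]
      by (cases "x = ?c") (auto simp: critical_excess_def)
  next
    case 3
    then have "critical_lorentz_factor d x > 1" "critical_lorentz_factor d y > 1"
      using critical_lorentz_factor_gt_1[OF d] assms by auto
    then show ?thesis using 3 by (simp add: critical_excess_def)
  qed
qed

text \<open>
  The intermediate value theorem is applied to \<open>critical_lorentz_factor\<close> on each side of the critical radius.
\<close>

lemma critical_excess_surj:
  assumes d: "d \<ge> 1"
  shows "\<exists>x>0. critical_excess d x = y"
proof -
  let ?c = "cmc_radius d" and ?h = "critical_lorentz_factor d"
  note c = cmc_radius_bounds(1)[OF d] cmc_radius_bounds(2)[of d]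
  have h: "isCont ?h x" if "x > 0" for x
    using critical_lorentz_factor_has_derivative[OF that] by (rule DERIV_isCont)
  have hc: "?h ?c = 1" by (rule critical_lorentz_factor_at_radius[OF d])
  have h1: "\<exists>x. 0 < x \<and> x \<le> ?c \<and> ?h x = 1 + z" if "z \<ge> 0" for z
  proof -
    \<comment> \<open>With this choice \<open>(1 - c) * (c / a) = 1 + z\<close>, and raising \<open>c / a \<ge> 1\<close> to the power
      \<open>d \<ge> 1\<close> only increases it.\<close>
    define a where "a = ?c * (1 - ?c) / (1 + z)"
    have a: "0 < a" unfolding a_def using c that by (intro divide_pos_pos mult_pos_pos) auto
    have "?c * (1 - ?c) \<le> ?c * 1" using c by (intro mult_left_mono) auto
    also have "\<dots> \<le> ?c * (1 + z)" using c that by (intro mult_left_mono) auto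
    finally have ac: "a \<le> ?c" unfolding a_def using that by (simp add: divide_le_eq)
    then have ge1: "1 \<le> ?c / a" using a by simp
    have ca: "1 + z = (1 - ?c) * (?c / a)" using c that by (simp add: a_def)
    also have "\<dots> \<le> (1 - ?c) * (?c / a) ^ d"
      using self_le_power[OF ge1, of d] d c by (intro mult_left_mono) auto
    also have "\<dots> \<le> ?h a" using a by (simp add: critical_lorentz_factor_def)
    finally have "1 + z \<le> ?h a" .
    then have "\<exists>x\<ge>a. x \<le> ?c \<and> ?h x = 1 + z"
      using ac hc that a h by (intro IVT2) auto
    then obtain x where "a \<le> x" "x \<le> ?c" "?h x = 1 + z" by blast
    then show ?thesis using a by (intro exI[of _ x]) simp
  qed
  have h2: "\<exists>x. ?c \<le> x \<and> ?h x = 1 + z" if "z \<ge> 0" for z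
  proof -
    have "1 + z \<le> ?h (?c + 1 + z)"
      using c that by (simp add: critical_lorentz_factor_def add_increasing2)
    then have "\<exists>x\<ge>?c. x \<le> ?c + 1 + z \<and> ?h x = 1 + z"
      using hc that c h by (intro IVT) auto
    then show ?thesis by blast
  qed
  show ?thesis
  proof (cases "y \<ge> 0")
    case True
    then obtain x where x: "0 < x" "x \<le> ?c" "?h x = 1 + y" using h1 by blast
    then have "critical_excess d x = y"
      using hc by (cases "x = ?c") (auto simp: critical_excess_def)
    then show ?thesis using x by blast
  next
    case False
    then obtain x where x: "?c \<le> x" "?h x = 1 + (- y)" using h2[of "- y"] by auto
    then have "critical_excess d x = y"
      using hc by (cases "x = ?c") (auto simp: critical_excess_def)
    moreover have "x > 0" using x(1) c(1) by simp
    ultimately show ?thesis by blast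
  qed
qed

lemma the_cmc_solution_satisfiesI:
  assumes "r > 0" "\<bar>l\<bar> < 1"
    and "\<And>f J. maximal_cmc_solution_with_data d t0 r l f J \<Longrightarrow> P f J"
  shows "the_cmc_solution_satisfies d t0 r l P"
  using maximal_cmc_solution_exists[OF assms(1,2)] assms(3)
  unfolding the_cmc_solution_satisfies_def by blast

text \<open>
  The three outcomes of \<open>cmc_trichotomy\<close> exclude each other: a solution that converges to the critical
  radius is bounded near infinity, and being defined on \<open>{t0..}\<close> it is positive and continuous at every
  later time, so it cannot tend to zero at one of them.
\<close>

lemma has_critical_data_iff:
  assumes d: "d \<ge> 1" and r: "r > 0" and l: "\<bar>l\<bar> < 1"
  shows "has_critical_data d t0 r l \<longleftrightarrow> signed_lorentz_excess l = critical_excess d r"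
proof
  assume "signed_lorentz_excess l = critical_excess d r"
  then show "has_critical_data d t0 r l"
    unfolding has_critical_data_def
    using cmc_trichotomy(3)[OF d] by (intro the_cmc_solution_satisfiesI r l) (simp add: cmc_radius_def)
next
  assume crit: "has_critical_data d t0 r l"
  obtain f J where max: "maximal_cmc_solution_with_data d t0 r l f J"
    using maximal_cmc_solution_exists[OF r l] by blast
  with crit have J: "{t0..} \<subseteq> J" and lim: "(f \<longlongrightarrow> cmc_radius d) at_top"
    unfolding has_critical_data_def the_cmc_solution_satisfies_def converges_to_future_def cmc_radius_def
    by blast+
  have sol: "cmc_solution d f J"
    using max maximal_cmc_solutionD unfolding maximal_cmc_solution_with_data_def by blast
  have "\<not> expands_indefinitely t0 f J"
    unfolding expands_indefinitely_def
    using lim not_tendsto_and_filterlim_at_infinity[of at_top f "cmc_radius d"]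
      filterlim_at_top_imp_at_infinity[of f at_top] by auto
  moreover have "\<not> collapses_in_finite_time t0 f J"
  proof
    assume "collapses_in_finite_time t0 f J"
    then obtain T where T: "T > t0" "(f \<longlongrightarrow> 0) (at_left T)"
      unfolding collapses_in_finite_time_def by blast
    then have TJ: "T \<in> J" using J by auto
    have "(f \<longlongrightarrow> f T) (at_left T)"
      using DERIV_isCont[OF cmc_solutionD(3)[OF sol TJ]]
      by (auto simp: isCont_def filterlim_at_split)
    then have "f T = 0" using tendsto_unique[OF _ _ T(2)] by simp
    then show False using cmc_solutionD(1)[OF sol TJ] by simp
  qed
  ultimately show "signed_lorentz_excess l = critical_excess d r"
    using cmc_trichotomy(1,2)[OF d max] by linarith
qed

theorem corollary2p12:
  fixes d :: nat and t0 :: real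
  assumes "d \<ge> 1"
  shows
    "(\<forall>r0>0.
        (\<exists>!l0. l0 \<in> {-1<..<1} \<and> has_critical_data d t0 r0 l0) \<and>
        (\<forall>l0\<in>{-1<..<1}. has_critical_data d t0 r0 l0 \<longrightarrow>
           (\<forall>l\<in>{l0<..<1}. the_cmc_solution_satisfies d t0 r0 l (expands_indefinitely t0)) \<and>
           (\<forall>l\<in>{-1<..<l0}. the_cmc_solution_satisfies d t0 r0 l (collapses_in_finite_time t0)))) \<and>
     (\<forall>l0\<in>{-1<..<1}.
        (\<exists>!r0. r0 > 0 \<and> has_critical_data d t0 r0 l0) \<and>
        (\<forall>r0>0. has_critical_data d t0 r0 l0 \<longrightarrow>
           (\<forall>r>r0. the_cmc_solution_satisfies d t0 r l0 (expands_indefinitely t0)) \<and>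
           (\<forall>r\<in>{0<..<r0}. the_cmc_solution_satisfies d t0 r l0 (collapses_in_finite_time t0))))"
proof -
  let ?S = "signed_lorentz_excess" and ?C = "critical_excess d"
  have crit: "has_critical_data d t0 r l \<longleftrightarrow> ?S l = ?C r" if "r > 0" "l \<in> {-1<..<1}" for r l
    using that by (intro has_critical_data_iff[OF assms]) auto
  have expands: "the_cmc_solution_satisfies d t0 r l (expands_indefinitely t0)"
    if "r > 0" "l \<in> {-1<..<1}" "?S l > ?C r" for r l
    by (rule the_cmc_solution_satisfiesI[OF _ _ cmc_trichotomy(1)[OF assms]]) (use that in auto)
  have collapses: "the_cmc_solution_satisfies d t0 r l (collapses_in_finite_time t0)"
    if "r > 0" "l \<in> {-1<..<1}" "?S l < ?C r" for r l
    by (rule the_cmc_solution_satisfiesI[OF _ _ cmc_trichotomy(2)[OF assms]]) (use that in auto)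
  have S: "?S u < ?S v" if "u < v" "u \<in> {-1<..<1}" "v \<in> {-1<..<1}" for u v
    using that by (intro signed_lorentz_excess_strict_mono) auto
  have C: "?C y < ?C x" if "0 < x" "x < y" for x y
    using that by (rule critical_excess_strict_antimono[OF assms])
  show ?thesis
  proof (intro conjI allI ballI impI)
    fix r0 :: real assume r0: "r0 > 0"
    obtain l where "\<bar>l\<bar> < 1" and lS: "?S l = ?C r0" using signed_lorentz_excess_surj by blast
    then have l: "l \<in> {-1<..<1}" by (simp add: abs_less_iff)
    show "\<exists>!l0. l0 \<in> {-1<..<1} \<and> has_critical_data d t0 r0 l0"
    proof (rule ex1I[of _ l])
      show "l \<in> {-1<..<1} \<and> has_critical_data d t0 r0 l"
        using l lS r0 crit[of r0 l] by simp
      show "l' = l" if "l' \<in> {-1<..<1} \<and> has_critical_data d t0 r0 l'" for l'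
      proof -
        have "?S l' = ?S l" using that crit[OF r0, of l'] lS by metis
        then show ?thesis using S[of l l'] S[of l' l] that l by (cases l l' rule: linorder_cases) auto
      qed
    qed
    fix l0 :: real assume l0: "l0 \<in> {-1<..<1}" and "has_critical_data d t0 r0 l0"
    then have eq: "?S l0 = ?C r0" using crit r0 by blast
    show "the_cmc_solution_satisfies d t0 r0 l (expands_indefinitely t0)" if "l \<in> {l0<..<1}" for l
      using expands[OF r0, of l] S[of l0 l] eq l0 that by auto
    show "the_cmc_solution_satisfies d t0 r0 l (collapses_in_finite_time t0)" if "l \<in> {-1<..<l0}" for l
      using collapses[OF r0, of l] S[of l l0] eq l0 that by auto
  next
    fix l0 :: real assume l0: "l0 \<in> {-1<..<1}"
    obtain r where r: "r > 0" "?C r = ?S l0" using critical_excess_surj[OF assms] by blast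
    show "\<exists>!r0. r0 > 0 \<and> has_critical_data d t0 r0 l0"
    proof (rule ex1I[of _ r])
      show "r > 0 \<and> has_critical_data d t0 r l0"
        using r l0 crit[of r l0] by simp
      show "r' = r" if "r' > 0 \<and> has_critical_data d t0 r' l0" for r'
      proof -
        have "?C r' = ?C r" using that crit[OF _ l0, of r'] r(2) by simp
        then show ?thesis using C[of r r'] C[of r' r] that r(1) by (cases r r' rule: linorder_cases) auto
      qed
    qed
    fix r0 :: real assume r0: "r0 > 0" and "has_critical_data d t0 r0 l0"
    then have eq: "?S l0 = ?C r0" using crit l0 by blast
    show "the_cmc_solution_satisfies d t0 r l0 (expands_indefinitely t0)" if "r > r0" for r
      by (rule expands) (use C[OF r0 that] r0 l0 that eq in auto)
    show "the_cmc_solution_satisfies d t0 r l0 (collapses_in_finite_time t0)" if "r \<in> {0<..<r0}" for r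
      by (rule collapses) (use C[of r r0] l0 that eq in auto)
  qed
qed

end
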